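(* Let $b>0$, $\sigma>0$, $\alpha,\beta>-1$, $\eta\in\mathbb{R}$, $\mu>0$ with $\alpha-\mu>-1$, and let $N\ge0$ be an integer. Let $x_r:=x_r^{(\alpha,\beta,\sigma)}$ and $w_r:=w_r^{(\alpha,\beta,\sigma)}$, $r=0,\dots,N$, be the mapped Gauss–Jacobi nodes and weights. Then the right-sided Erdélyi–Kober fractional differentiation matrix of order $\mu$, ${}^R\mathbf{D}^\mu=({}^rd_{s,i})_{s,i=0}^N$, i.e. the matrix satisfying $${}_xD^\mu_{b,\sigma,\eta}\left[\mathcal{I}_{2,N}u\right](x_s)=\sum_{i=0}^N {}^rd_{s,i}\,u(x_i),\qquad s=0,\dots,N,$$ for every continuous function $u$ on $(0,b)$, has entries $${}^rd_{s,i}=\left(\frac{1}{x_i}\right)^{\sigma\eta}\left(\frac1{b^\sigma-x_i^\sigma}\right)^{\alpha}\sum_{j=0}^N a_j^i\,\frac{\Gamma(j+\alpha+1)}{\Gamma(j+\alpha-\mu+1)}\;{}^2\mathcal{J}_j^{(\alpha-\mu,\beta+\mu,\sigma,\eta+\mu)}(x_s),$$ where $$a_j^i=\frac{w_i}{{}^*\gamma_j^{(\alpha,\beta)}}\,P_j^{(\alpha,\beta)}\left(2\left(\frac{x_i}{b}\right)^\sigma-1\right).$$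
   Context: $P_n^{(\alpha,\beta)}$ is the Jacobi polynomial of degree $n$ in the standard normalization $P_n^{(\alpha,\beta)}(1)=\binom{n+\alpha}{n}$. Constants: $\gamma_n^{(\alpha,\beta)}=\frac{2^{\alpha+\beta+1}\Gamma(n+\alpha+1)\Gamma(n+\beta+1)}{(2n+\alpha+\beta+1)\,n!\,\Gamma(n+\alpha+\beta+1)}$ (for $n=0$ the denominator is read as $\Gamma(\alpha+\beta+2)$), and ${}^*\gamma_n^{(\alpha,\beta)}=\frac1\sigma\left(\frac{b^\sigma}{2}\right)^{\alpha+\beta+1}\gamma_n^{(\alpha,\beta)}$. Let $x_r^{(\alpha,\beta)}$, $w_r^{(\alpha,\beta)}$, $r=0,\dots,N$, be the nodes and weights of the $(N+1)$-point Gauss–Jacobi quadrature on $[-1,1]$ for the weight $(1-y)^\alpha(1+y)^\beta$. Mapped nodes and weights: $$x_r^{(\alpha,\beta,\sigma)}=b\left(\frac{1+x_r^{(\alpha,\beta)}}2\right)^{1/\sigma},\qquad w_r^{(\alpha,\beta,\sigma)}=\frac1\sigma\left(\frac{b^\sigma}2\right)^{\alpha+\beta+1}w_r^{(\alpha,\beta)}.$$ Jacobi–Müntz functions of the second kind: ${}^2\mathcal{J}_n^{(\alpha,\beta,\sigma,\eta)}(x)=x^{\sigma\eta}(b^\sigma-x^\sigma)^\alpha P_n^{(\alpha,\beta)}\left(2(x/b)^\sigma-1\right)$. Interpolant: $\mathcal{I}_{2,N}u(x)=\sum_{i=0}^N u(x_i)\left(\frac{x}{x_i}\right)^{\sigma\eta}\left(\frac{b^\sigma-x^\sigma}{b^\sigma-x_i^\sigma}\right)^\alpha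 h_i^\sigma(x)$ with $h_i^\sigma(x)=\prod_{j\ne i}\frac{x^\sigma-x_j^\sigma}{x_i^\sigma-x_j^\sigma}$. Right Erdélyi–Kober fractional integral (for $\nu>0$) and derivative (for $n-1<\mu\le n$, $n\in\mathbb{N}$): $${}_xI^\nu_{b,\sigma,\eta}[f](x)=\frac{\sigma x^{\sigma\eta}}{\Gamma(\nu)}\int_x^b(t^\sigma-x^\sigma)^{\nu-1}t^{-\sigma(\eta+\nu-1)-1}f(t)\,dt,$$ $${}_xD^\mu_{b,\sigma,\eta}[f](x)=x^{\sigma(\eta+\mu)}\left(\frac{-1}{\sigma x^{\sigma-1}}\frac{d}{dx}\right)^n x^{-\sigma(\mu+\eta-n)}\,{}_xI^{n-\mu}_{b,\sigma,\eta+\mu-n}[f](x),$$ with ${}_xI^0$ the identity. *)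

theory Defs
  imports "HOL-Analysis.Analysis" "HOL-Computational_Algebra.Polynomial"
begin

section \<open>Jacobi polynomials and Gauss--Jacobi quadrature\<close>

text \<open>
  The expansion of the Jacobi polynomial in powers of (x - 1)/2. It is the terminating
  hypergeometric representation with the Gamma quotients written as binomial coefficients.
\<close>

definition jacobi_poly :: "nat \<Rightarrow> real \<Rightarrow> real \<Rightarrow> real poly" where
  "jacobi_poly n \<alpha> \<beta> =
     (\<Sum>k\<le>n. smult (((real n + \<alpha>) gchoose (n - k)) * ((real n + \<alpha> + \<beta> + real k) gchoose k))
                  ([:- 1 / 2, 1 / 2:] ^ k))"

lemma poly_jacobi_poly_at_1: "poly (jacobi_poly n \<alpha> \<beta>) 1 = (real n + \<alpha>) gchoose n"
proof -
  have "poly (jacobi_poly n \<alpha> \<beta>) 1 =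
    (\<Sum>k\<le>n. ((real n + \<alpha>) gchoose (n - k)) * ((real n + \<alpha> + \<beta> + real k) gchoose k) * 0 ^ k)"
    by (simp add: jacobi_poly_def poly_sum)
  also have "\<dots> = (\<Sum>k\<in>{0}. ((real n + \<alpha>) gchoose (n - k)) *
                   ((real n + \<alpha> + \<beta> + real k) gchoose k) * 0 ^ k)"
    by (rule sum.mono_neutral_right) auto
  finally show ?thesis by simp
qed

text \<open>The squared weighted norm of the Jacobi polynomial of degree n.\<close>

definition jacobi_gamma :: "nat \<Rightarrow> real \<Rightarrow> real \<Rightarrow> real" where
  "jacobi_gamma n \<alpha> \<beta> =
     2 powr (\<alpha> + \<beta> + 1) * Gamma (real n + \<alpha> + 1) * Gamma (real n + \<beta> + 1) /
     (if n = 0 then Gamma (\<alpha> + \<beta> + 2)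
      else (2 * real n + \<alpha> + \<beta> + 1) * fact n * Gamma (real n + \<alpha> + \<beta> + 1))"

text \<open>
  The nodes of the (N+1)-point rule are the zeros of the Jacobi polynomial of degree N+1,
  listed in increasing order; the weights are the integrals of the Lagrange basis
  polynomials against the Jacobi weight. The index r ranges over 0, ..., N.
\<close>

definition gauss_jacobi_node :: "nat \<Rightarrow> real \<Rightarrow> real \<Rightarrow> nat \<Rightarrow> real" where
  "gauss_jacobi_node N \<alpha> \<beta> r =
     sorted_list_of_set {y. poly (jacobi_poly (N + 1) \<alpha> \<beta>) y = 0} ! r"

definition gauss_jacobi_weight :: "nat \<Rightarrow> real \<Rightarrow> real \<Rightarrow> nat \<Rightarrow> real" where
  "gauss_jacobi_weight N \<alpha> \<beta> r =
     integral {-1..1} (\<lambda>y. (1 - y) powr \<alpha> * (1 + y) powr \<beta> *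
       (\<Prod>j\<in>{..N} - {r}. (y - gauss_jacobi_node N \<alpha> \<beta> j) /
                           (gauss_jacobi_node N \<alpha> \<beta> r - gauss_jacobi_node N \<alpha> \<beta> j)))"


section \<open>Mapped quantities on the interval from 0 to b\<close>

definition mapped_node :: "real \<Rightarrow> real \<Rightarrow> nat \<Rightarrow> real \<Rightarrow> real \<Rightarrow> nat \<Rightarrow> real" where
  "mapped_node b \<sigma> N \<alpha> \<beta> r = b * ((1 + gauss_jacobi_node N \<alpha> \<beta> r) / 2) powr (1 / \<sigma>)"

definition mapped_weight :: "real \<Rightarrow> real \<Rightarrow> nat \<Rightarrow> real \<Rightarrow> real \<Rightarrow> nat \<Rightarrow> real" where
  "mapped_weight b \<sigma> N \<alpha> \<beta> r =
     1 / \<sigma> * (b powr \<sigma> / 2) powr (\<alpha> + \<beta> + 1) * gauss_jacobi_weight N \<alpha> \<beta> r"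

definition mapped_gamma :: "real \<Rightarrow> real \<Rightarrow> nat \<Rightarrow> real \<Rightarrow> real \<Rightarrow> real" where
  "mapped_gamma b \<sigma> n \<alpha> \<beta> =
     1 / \<sigma> * (b powr \<sigma> / 2) powr (\<alpha> + \<beta> + 1) * jacobi_gamma n \<alpha> \<beta>"

text \<open>Jacobi--Muentz functions of the second kind.\<close>

definition jacobi_muntz2 ::
  "real \<Rightarrow> nat \<Rightarrow> real \<Rightarrow> real \<Rightarrow> real \<Rightarrow> real \<Rightarrow> real \<Rightarrow> real" where
  "jacobi_muntz2 b n \<alpha> \<beta> \<sigma> \<eta> x =
     x powr (\<sigma> * \<eta>) * (b powr \<sigma> - x powr \<sigma>) powr \<alpha> *
     poly (jacobi_poly n \<alpha> \<beta>) (2 * (x / b) powr \<sigma> - 1)"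

text \<open>The interpolant at arbitrary nodes xs 0, ..., xs N.\<close>

definition muntz_lagrange :: "real \<Rightarrow> nat \<Rightarrow> (nat \<Rightarrow> real) \<Rightarrow> nat \<Rightarrow> real \<Rightarrow> real" where
  "muntz_lagrange \<sigma> N xs i x =
     (\<Prod>j\<in>{..N} - {i}. (x powr \<sigma> - xs j powr \<sigma>) / (xs i powr \<sigma> - xs j powr \<sigma>))"

definition interpolant2 ::
  "real \<Rightarrow> real \<Rightarrow> real \<Rightarrow> real \<Rightarrow> nat \<Rightarrow> (nat \<Rightarrow> real) \<Rightarrow> (real \<Rightarrow> real) \<Rightarrow> real \<Rightarrow> real" where
  "interpolant2 b \<alpha> \<sigma> \<eta> N xs u x =
     (\<Sum>i\<le>N. u (xs i) * (x / xs i) powr (\<sigma> * \<eta>) *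
        ((b powr \<sigma> - x powr \<sigma>) / (b powr \<sigma> - xs i powr \<sigma>)) powr \<alpha> *
        muntz_lagrange \<sigma> N xs i x)"


section \<open>Right Erdelyi--Kober operators\<close>

definition EK_integrand ::
  "real \<Rightarrow> real \<Rightarrow> real \<Rightarrow> (real \<Rightarrow> real) \<Rightarrow> real \<Rightarrow> real \<Rightarrow> real" where
  "EK_integrand \<sigma> \<eta> \<nu> f x t =
     (t powr \<sigma> - x powr \<sigma>) powr (\<nu> - 1) * t powr (- \<sigma> * (\<eta> + \<nu> - 1) - 1) * f t"

definition EK_integral ::
  "real \<Rightarrow> real \<Rightarrow> real \<Rightarrow> real \<Rightarrow> (real \<Rightarrow> real) \<Rightarrow> real \<Rightarrow> real" where
  "EK_integral b \<sigma> \<eta> \<nu> f x =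
     (if \<nu> = 0 then f x
      else \<sigma> * x powr (\<sigma> * \<eta>) / Gamma \<nu> * integral {x..b} (EK_integrand \<sigma> \<eta> \<nu> f x))"

definition EK_diff_op :: "real \<Rightarrow> (real \<Rightarrow> real) \<Rightarrow> real \<Rightarrow> real" where
  "EK_diff_op \<sigma> g x = - 1 / (\<sigma> * x powr (\<sigma> - 1)) * deriv g x"

text \<open>
  The function to which the iterated first-order operator is applied in the definition of the
  derivative; for positive \<mu> the number n with n - 1 < \<mu> \<le> n is the ceiling of \<mu>.
\<close>

definition EK_inner ::
  "real \<Rightarrow> real \<Rightarrow> real \<Rightarrow> real \<Rightarrow> (real \<Rightarrow> real) \<Rightarrow> real \<Rightarrow> real" where
  "EK_inner b \<sigma> \<eta> \<mu> f x =
     (let n = nat \<lceil>\<mu>\<rceil> in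
        x powr (- \<sigma> * (\<mu> + \<eta> - real n)) *
        EK_integral b \<sigma> (\<eta> + \<mu> - real n) (real n - \<mu>) f x)"

definition EK_deriv ::
  "real \<Rightarrow> real \<Rightarrow> real \<Rightarrow> real \<Rightarrow> (real \<Rightarrow> real) \<Rightarrow> real \<Rightarrow> real" where
  "EK_deriv b \<sigma> \<eta> \<mu> f x =
     x powr (\<sigma> * (\<eta> + \<mu>)) * (EK_diff_op \<sigma> ^^ nat \<lceil>\<mu>\<rceil>) (EK_inner b \<sigma> \<eta> \<mu> f) x"

text \<open>
  Both integral and deriv are total functions in the library. The following predicate says
  that the integrals (as Lebesgue integrals) and the derivatives occurring in
  EK_deriv genuinely exist in a neighbourhood of x, so that its value there is meaningful.
\<close>

definition EK_deriv_exists ::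
  "real \<Rightarrow> real \<Rightarrow> real \<Rightarrow> real \<Rightarrow> (real \<Rightarrow> real) \<Rightarrow> real \<Rightarrow> bool" where
  "EK_deriv_exists b \<sigma> \<eta> \<mu> f x \<longleftrightarrow>
     (let n = nat \<lceil>\<mu>\<rceil> in
      \<forall>\<^sub>F z in nhds x.
        (\<mu> < real n \<longrightarrow>
           EK_integrand \<sigma> (\<eta> + \<mu> - real n) (real n - \<mu>) f z absolutely_integrable_on {z..b}) \<and>
        (\<forall>k<n. (EK_diff_op \<sigma> ^^ k) (EK_inner b \<sigma> \<eta> \<mu> f) field_differentiable at z))"

text \<open>
  A matrix with rows and columns indexed by 0, ..., N is a function of two indices of which
  only the values at indices up to N matter.
\<close>

definition is_right_EK_diff_matrix ::
  "real \<Rightarrow> real \<Rightarrow> real \<Rightarrow> real \<Rightarrow> real \<Rightarrow> nat \<Rightarrow> (nat \<Rightarrow> real) \<Rightarrow> (nat \<Rightarrow> nat \<Rightarrow> real) \<Rightarrow> bool" where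
  "is_right_EK_diff_matrix b \<alpha> \<sigma> \<eta> \<mu> N xs d \<longleftrightarrow>
     (\<forall>u. continuous_on {0<..<b} u \<longrightarrow>
        (\<forall>s\<le>N. EK_deriv b \<sigma> \<eta> \<mu> (interpolant2 b \<alpha> \<sigma> \<eta> N xs u) (xs s) =
                 (\<Sum>i\<le>N. d s i * u (xs i))))"

end

theory Submission
  imports Defs
begin

text \<open>
  In the variable X = x powr \<sigma> the Erdelyi--Kober derivative of x powr (\<sigma> \<eta>) * g(X) is, up to a
  power of x, the right Riemann--Liouville derivative of g at X with terminal B = b powr \<sigma>, and this
  maps (B - X) powr e to Gamma (e + 1) / Gamma (e - \<mu> + 1) * (B - X) powr (e - \<mu>). Applied
  to the expansion of a Jacobi polynomial in powers of B - X, these Gamma factors turn its coefficients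
  into those for the parameters \<alpha> - \<mu>, \<beta> + \<mu>. It remains to expand the Lagrange basis
  polynomials in Jacobi polynomials: the coefficients are weighted inner products, and the Gauss rule,
  exact because the nodal polynomial is orthogonal to all polynomials of smaller degree, evaluates
  each of them by the single node at which the basis polynomial does not vanish.
\<close>

section \<open>Beta integrals and a Chu--Vandermonde sum\<close>

text \<open>The integral runs up to b, so powers of B - X are the functions on which the fractional
  operators act simply; hence \<open>jacobi_poly\<close> is used through its expansion at y = 1.
  Orthogonality and norm come from one closed form, the weighted integral of a Jacobi polynomial
  times (1 + y)^m, which is a Chu--Vandermonde sum of Beta integrals; neither Rodrigues' formula nor
  integration by parts enters. Gamma quotients carry \<open>rGamma\<close>, which is entire:
  \<open>e * rGamma (e + 1) = rGamma e\<close> holds for every real e, so iterating the differential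
  operator needs no case distinction at poles. \<open>integral\<close> and \<open>deriv\<close> are
  total and \<open>0 powr a = 0\<close>, so pointwise identities are proved on open intervals, where
  all bases are positive, and existence is proved alongside the value. The matrix is unique because
  the nodes are distinct: a polynomial with a single 1 among its node values, and 0 elsewhere,
  isolates each entry.\<close>

lemma Beta_integral_pullback:
  fixes g g' :: "real \<Rightarrow> real" and p q l r :: real
  assumes "p > 0" "q > 0"
    and deriv: "\<And>t. t \<in> {l<..<r} \<Longrightarrow> (g has_field_derivative g' t) (at t)"
    and inj: "inj_on g {l<..<r}" and image: "g ` {l<..<r} = {0<..<1}"
  shows "(\<lambda>t. \<bar>g' t\<bar> * (g t powr (p - 1) * (1 - g t) powr (q - 1)))
           absolutely_integrable_on {l<..<r}"
    and "integral {l<..<r} (\<lambda>t. \<bar>g' t\<bar> * (g t powr (p - 1) * (1 - g t) powr (q - 1))) = Beta p q"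
proof -
  let ?f = "\<lambda>t::real. t powr (p - 1) * (1 - t) powr (q - 1)"
  have B: "(?f has_integral Beta p q) {0..1}"
    by (rule has_integral_Beta_real) (use assms in auto)
  \<comment> \<open>Differentiability and injectivity of \<open>g\<close> are given only inside the
    interval, so the endpoints are dropped first. The Jacobian carries an absolute value because (1
    - y) / 2, one of the two substitutions made later, is decreasing.\<close>
  then have B': "(?f has_integral Beta p q) {0<..<1}"
    by (simp add: has_integral_Icc_iff_Ioo)
  have "?f absolutely_integrable_on {0<..<1}"
    by (rule nonnegative_absolutely_integrable_1) (use B' in auto)
  moreover have "integral {0<..<1} ?f = Beta p q"
    using B' by (rule integral_unique)
  ultimately have "?f absolutely_integrable_on g ` {l<..<r} \<and> integral (g ` {l<..<r}) ?f = Beta p q"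
    by (simp add: image)
  then have "(\<lambda>t. \<bar>g' t\<bar> * ?f (g t)) absolutely_integrable_on {l<..<r} \<and>
      integral {l<..<r} (\<lambda>t. \<bar>g' t\<bar> * ?f (g t)) = Beta p q"
    by (subst has_absolute_integral_change_of_variables_1' [where f = ?f])
       (use inj in \<open>auto intro!: has_field_derivative_at_within deriv\<close>)
  then show "(\<lambda>t. \<bar>g' t\<bar> * ?f (g t)) absolutely_integrable_on {l<..<r}"
    and "integral {l<..<r} (\<lambda>t. \<bar>g' t\<bar> * ?f (g t)) = Beta p q" by simp_all
qed

text \<open>This is the terminating 2F1 at 1, normalised by 1 / Gamma d so that every real d is
  allowed. Pascal's rule and \<open>pochhammer_rec\<close> split the sum into the instances (c, d)
  and (c + 1, d + 1) for n. Both have the same d - c, so \<open>pochhammer (d - c) n\<close> factors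
  out, and one recurrence step of \<open>rGamma\<close> finishes.\<close>

lemma Chu_Vandermonde_rGamma:
  fixes c d :: real
  shows "(\<Sum>k\<le>n. real (n choose k) * (-1) ^ k * pochhammer c k * rGamma (d + real k)) =
           pochhammer (d - c) n * rGamma (d + real n)"
proof (induction n arbitrary: c d)
  case 0
  then show ?case by simp
next
  case (Suc n)
  let ?t = "\<lambda>n c d k. real (n choose k) * (-1) ^ k * pochhammer c k * rGamma (d + real k)"
  have "(\<Sum>k\<le>Suc n. ?t (Suc n) c d k) = 
     ?t (Suc n) c d 0 + (\<Sum>k\<le>n. ?t (Suc n) c d (Suc k))"
    by (rule sum.atMost_Suc_shift)
  also have "(\<Sum>k\<le>n. ?t (Suc n) c d (Suc k)) =
     (\<Sum>k\<le>n. ?t n c d (Suc k)) - c * (\<Sum>k\<le>n. ?t n (c + 1) (d + 1) k)"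
    unfolding sum_distrib_left sum_subtractf [symmetric]
    by (intro sum.cong refl) (simp add: pochhammer_rec algebra_simps)
  also have "?t (Suc n) c d 0 + \<dots> = (\<Sum>k\<le>Suc n. ?t n c d k) - c * (\<Sum>k\<le>n. ?t n (c + 1) (d + 1) k)"
    by (subst sum.atMost_Suc_shift) simp
  also have "(\<Sum>k\<le>Suc n. ?t n c d k) = (\<Sum>k\<le>n. ?t n c d k)"
    by simp
  also have "\<dots> - c * (\<Sum>k\<le>n. ?t n (c + 1) (d + 1) k) =
      pochhammer (d - c) n * (rGamma (d + real n) - c * rGamma (d + real n + 1))"
    by (simp only: Suc.IH) (simp add: algebra_simps)
  also have "rGamma (d + real n) = (d + real n) * rGamma (d + real n + 1)"
    by (rule rGamma_plus1 [symmetric])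
  finally show ?case
    by (simp add: pochhammer_Suc algebra_simps)
qed

lemma gbinomial_add_eq_pochhammer:
  "(x + real k) gchoose k = pochhammer (x + 1) k / fact k"
  by (simp add: gbinomial_pochhammer')

text \<open>The binomial depends on k through 1 / (Gamma (x + k + 1) (n - k)!), so the product sheds
  its Gamma factor in k. Used with x = \<alpha> in the moment sum, and with x = \<alpha> and x =
  \<alpha> - \<mu> for the derivative.\<close>

lemma Gamma_mult_gbinomial_diff:
  fixes x :: real
  assumes "x > -1" "k \<le> n"
  shows "Gamma (x + real k + 1) * ((real n + x) gchoose (n - k)) = Gamma (real n + x + 1) / fact (n - k)"
proof -
  have "(real n + x) gchoose (n - k) = pochhammer (x + real k + 1) (n - k) / fact (n - k)"
    using assms(2) by (simp add: gbinomial_pochhammer' add_ac)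
  also have "pochhammer (x + real k + 1) (n - k) = Gamma (real n + x + 1) / Gamma (x + real k + 1)"
    using assms by (subst pochhammer_Gamma) (auto simp: add_ac nonpos_Ints_def)
  moreover have "x + real k + 1 > 0"
    using assms(1) by linarith
  then have "Gamma (x + real k + 1) \<noteq> 0"
    using Gamma_real_pos by (metis less_irrefl)
  ultimately show ?thesis by simp
qed

section \<open>Jacobi polynomials and Gauss--Jacobi quadrature\<close>

lemma degree_jacobi_poly_le: "degree (jacobi_poly n \<alpha> \<beta>) \<le> n"
  unfolding jacobi_poly_def
proof (rule degree_sum_le)
  fix k assume "k \<in> {..n}"
  have "degree ([:- 1 / 2, 1 / 2:] ^ k :: real poly) \<le> k"
    by (simp add: degree_power_eq)
  with \<open>k \<in> {..n}\<close> show "degree (smult (((real n + \<alpha>) gchoose (n - k)) *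
      ((real n + \<alpha> + \<beta> + real k) gchoose k)) ([:- 1 / 2, 1 / 2:] ^ k)) \<le> n"
    by (meson atMost_iff degree_smult_le order_trans)
qed simp

lemma coeff_jacobi_poly:
  "coeff (jacobi_poly n \<alpha> \<beta>) n = ((2 * real n + \<alpha> + \<beta>) gchoose n) / 2 ^ n"
proof -
  have lc: "coeff ([:- 1 / 2, 1 / 2:] ^ n :: real poly) n = 1 / 2 ^ n"
    using lead_coeff_power [of "[:- 1 / 2, 1 / 2:] :: real poly" n]
    by (simp add: degree_power_eq power_one_over)
  have "coeff (jacobi_poly n \<alpha> \<beta>) n = (\<Sum>k\<in>{n}. ((real n + \<alpha>) gchoose (n - k)) *
      ((real n + \<alpha> + \<beta> + real k) gchoose k) * coeff ([:- 1 / 2, 1 / 2:] ^ k :: real poly) n)"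
    unfolding jacobi_poly_def coeff_sum coeff_smult
    by (rule sum.mono_neutral_right) (auto intro!: coeff_eq_0 simp: degree_power_eq)
  also have "\<dots> = ((2 * real n + \<alpha> + \<beta>) gchoose n) / 2 ^ n"
    by (subst sum.insert) (simp_all only: lc, simp_all add: algebra_simps)
  finally show ?thesis .
qed

lemma coeff_jacobi_poly_pos:
  assumes "\<alpha> > -1" "\<beta> > -1"
  shows "coeff (jacobi_poly n \<alpha> \<beta>) n > 0"
\<comment> \<open>For n = 0 the Pochhammer base \<alpha> + \<beta> + 1 can be negative; from n = 1
  on it exceeds n - 1.\<close>
proof (cases "n = 0")
  case True
  then show ?thesis by (simp add: coeff_jacobi_poly)
next
  case False
  have "(2 * real n + \<alpha> + \<beta>) gchoose n = pochhammer (real n + \<alpha> + \<beta> + 1) n / fact n"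
    using gbinomial_add_eq_pochhammer [of "real n + \<alpha> + \<beta>" n] by (simp add: algebra_simps)
  moreover have "pochhammer (real n + \<alpha> + \<beta> + 1) n > 0"
    using assms False by (intro pochhammer_pos) (auto simp flip: One_nat_def)
  ultimately show ?thesis
    by (simp add: coeff_jacobi_poly)
qed

lemma degree_jacobi_poly:
  assumes "\<alpha> > -1" "\<beta> > -1"
  shows "degree (jacobi_poly n \<alpha> \<beta>) = n"
  by (metis assms coeff_jacobi_poly_pos degree_jacobi_poly_le le_antisym le_degree less_irrefl)

text \<open>Triangular elimination of the leading coefficient. Applied to the powers of 1 + y for
  orthogonality and to the Jacobi polynomials for the expansion of the Lagrange basis.\<close>

lemma poly_eq_sum_of_graded_basis:
  fixes q :: "'a :: field poly"
  assumes "\<And>k. k \<le> n \<Longrightarrow> degree (e k) = k" "\<And>k. k \<le> n \<Longrightarrow> e k \<noteq> 0" "degree q \<le> n"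
  obtains c where "q = (\<Sum>k\<le>n. smult (c k) (e k))"
proof -
  have "\<exists>c. q = (\<Sum>k\<le>n. smult (c k) (e k))"
    using assms
  proof (induction n arbitrary: q)
    case 0
    then have d: "degree (e 0) = 0" "e 0 \<noteq> 0" "degree q = 0" by auto
    obtain u v where "e 0 = [:u:]" "q = [:v:]"
      using d degree_eq_zeroE by metis
    with d have "q = smult (v / u) (e 0)" by simp
    then show ?case by (intro exI [of _ "\<lambda>_. v / u"]) simp
  next
    case (Suc n)
    define t where "t = coeff q (Suc n) / coeff (e (Suc n)) (Suc n)"
    have d: "degree (e (Suc n)) = Suc n" "e (Suc n) \<noteq> 0"
      using Suc.prems by auto
    then have "coeff (e (Suc n)) (Suc n) \<noteq> 0"
      by (metis leading_coeff_0_iff)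
    then have 0: "coeff (q - smult t (e (Suc n))) (Suc n) = 0"
      by (simp add: t_def)
    have "degree (q - smult t (e (Suc n))) \<le> Suc n"
      using Suc.prems(3) d by (intro degree_diff_le) (auto intro: order_trans [OF degree_smult_le])
    with 0 have "degree (q - smult t (e (Suc n))) \<le> n"
      by (metis degree_0 leading_coeff_0_iff le_SucE zero_le)
    then obtain c where "q - smult t (e (Suc n)) = (\<Sum>k\<le>n. smult (c k) (e k))"
      using Suc by (metis le_SucI)
    then have "q = (\<Sum>k\<le>Suc n. smult ((c(Suc n := t)) k) (e k))"
      by (simp add: algebra_simps)
    then show ?case by blast
  qed
  with that show ?thesis by blast
qed

text \<open>The factors cancel the sign changes of p one root at a time.\<close>

lemma poly_constant_sign_factor:
  fixes p :: "real poly"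
  assumes "p \<noteq> 0"
  obtains Z where "Z \<subseteq> {z. poly p z = 0}" "Z \<subseteq> {a<..<b}"
    "(\<forall>y\<in>{a<..<b}. poly (p * (\<Prod>z\<in>Z. [:- z, 1:])) y \<ge> 0) \<or>
     (\<forall>y\<in>{a<..<b}. poly (p * (\<Prod>z\<in>Z. [:- z, 1:])) y \<le> 0)"
proof -
  define sgn_ok where "sgn_ok q \<longleftrightarrow> (\<forall>y\<in>{a<..<b}. poly q y \<ge> 0) \<or> (\<forall>y\<in>{a<..<b}. poly q y \<le> 0)"
    for q :: "real poly"
  have "\<exists>Z\<subseteq>{z. poly p z = 0} \<inter> {a<..<b}. sgn_ok (p * (\<Prod>z\<in>Z. [:- z, 1:]))"
    using assms
  proof (induction "degree p" arbitrary: p rule: less_induct)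
    case less
    show ?case
    proof (cases "\<exists>z\<in>{a<..<b}. poly p z = 0")
      case False
      have "sgn_ok p"
      proof (rule ccontr)
        assume "\<not> sgn_ok p"
        then obtain s t where "s \<in> {a<..<b}" "t \<in> {a<..<b}" "poly p s < 0" "poly p t > 0"
          unfolding sgn_ok_def by force
        moreover from this have "s < t \<or> t < s" by (metis less_asym linorder_neqE)
        ultimately have "\<exists>z\<in>{a<..<b}. poly p z = 0"
          using poly_IVT_pos [of s t p] poly_IVT_neg [of t s p] by fastforce
        with False show False by blast
      qed
      then show ?thesis by (intro exI [of _ "{}"]) simp
    next
      case True
      then obtain z q where z: "z \<in> {a<..<b}" "poly p z = 0" and p: "p = [:- z, 1:] * q"
        by (metis dvdE poly_eq_0_iff_dvd)
      have "q \<noteq> 0" using p less.prems by auto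
      then have "degree q < degree p" unfolding p by (subst degree_mult_eq) auto
      then obtain Z where Z: "Z \<subseteq> {z. poly q z = 0} \<inter> {a<..<b}"
        and ok: "sgn_ok (q * (\<Prod>z\<in>Z. [:- z, 1:]))"
        using less.hyps \<open>q \<noteq> 0\<close> by blast
      have fin: "finite Z"
        using poly_roots_finite [OF \<open>q \<noteq> 0\<close>] Z by (meson finite_subset le_infE)
      have roots: "{z. poly q z = 0} \<subseteq> {z. poly p z = 0}"
        by (auto simp: p)
      show ?thesis
      \<comment> \<open>The root z is toggled in Z. If it is there, the factor split off from p
        takes over its role; otherwise inserting it completes a square, which does not affect the
        sign.\<close>
      proof (cases "z \<in> Z")
        case True
        have "p * (\<Prod>z\<in>Z - {z}. [:- z, 1:]) = q * (\<Prod>z\<in>Z. [:- z, 1:])"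
          unfolding p prod.remove [OF fin True] by (simp only: mult_ac)
        with ok Z roots show ?thesis by (intro exI [of _ "Z - {z}"]) auto
      next
        case False
        have "p * (\<Prod>z\<in>insert z Z. [:- z, 1:]) = [:- z, 1:]\<^sup>2 * (q * (\<Prod>z\<in>Z. [:- z, 1:]))"
          unfolding p prod.insert [OF fin False] power2_eq_square by (simp only: mult_ac)
        moreover have "sgn_ok ([:- z, 1:]\<^sup>2 * (q * (\<Prod>z\<in>Z. [:- z, 1:])))"
          using ok unfolding sgn_ok_def poly_mult [of "[:- z, 1:]\<^sup>2"] poly_power
          by (meson mult_nonneg_nonneg mult_nonneg_nonpos zero_le_power2)
        ultimately show ?thesis
          using Z roots z by (intro exI [of _ "insert z Z"]) auto
      qed
    qed
  qed
  then obtain Z where "Z \<subseteq> {z. poly p z = 0} \<inter> {a<..<b}" "sgn_ok (p * (\<Prod>z\<in>Z. [:- z, 1:]))"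
    by blast
  then show ?thesis
    unfolding sgn_ok_def by (intro that [of Z]) simp_all
qed

text \<open>An element of \<open>poly\<close> rather than a function, because its degree and a
  division with remainder are needed. It serves the Gauss nodes and also, for uniqueness of the
  matrix, the mapped nodes.\<close>

definition lagrange_basis_poly :: "nat \<Rightarrow> (nat \<Rightarrow> real) \<Rightarrow> nat \<Rightarrow> real poly" where
  "lagrange_basis_poly N y i = (\<Prod>j\<in>{..N} - {i}. smult (1 / (y i - y j)) [:- y j, 1:])"

lemma poly_lagrange_basis_poly:
  "poly (lagrange_basis_poly N y i) t = (\<Prod>j\<in>{..N} - {i}. (t - y j) / (y i - y j))"
  unfolding lagrange_basis_poly_def poly_prod
  by (intro prod.cong) (auto simp: diff_divide_distrib)

lemma poly_lagrange_basis_poly_node: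
  assumes "inj_on y {..N}" "i \<le> N" "j \<le> N"
  shows "poly (lagrange_basis_poly N y i) (y j) = (if i = j then 1 else 0)"
proof (cases "i = j")
  case True
  have "y i \<noteq> y k" if "k \<in> {..N} - {i}" for k
    using assms that by (auto dest: inj_onD)
  then show ?thesis
    using True by (auto simp: poly_lagrange_basis_poly intro!: prod.neutral)
next
  case False
  then show ?thesis
    using assms by (auto simp: poly_lagrange_basis_poly intro!: bexI [of _ j])
qed

lemma degree_lagrange_basis_poly_le:
  assumes "i \<le> N"
  shows "degree (lagrange_basis_poly N y i) \<le> N"
proof -
  have "degree (lagrange_basis_poly N y i) \<le>
      (\<Sum>j\<in>{..N} - {i}. degree (smult (1 / (y i - y j)) [:- y j, 1:]))"
    unfolding lagrange_basis_poly_def by (rule degree_prod_sum_le [unfolded o_def]) simp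
  also have "\<dots> \<le> (\<Sum>j\<in>{..N} - {i}. 1)"
    by (intro sum_mono) simp
  also have "\<dots> = N"
    using assms by simp
  finally show ?thesis .
qed

text \<open>The substitution (1 - y) / 2 gives a Beta integral; p + q in the exponent of 2 comes
  from the two factors and the 1 from the Jacobian.\<close>

lemma has_integral_jacobi_weight:
  fixes p q :: real
  assumes "p > -1" "q > -1"
  shows "((\<lambda>y. (1 - y) powr p * (1 + y) powr q) has_integral
           2 powr (p + q + 1) * Beta (p + 1) (q + 1)) {-1..1}"
proof -
  let ?g = "\<lambda>y::real. (1 - y) / 2"
  let ?h = "\<lambda>y. \<bar>- 1 / 2\<bar> * (?g y powr (p + 1 - 1) * (1 - ?g y) powr (q + 1 - 1))"
  have image: "?g ` {-1<..<1} = {0<..<1}"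
  proof
    show "{0<..<1} \<subseteq> ?g ` {-1<..<1}"
    proof
      fix t :: real assume "t \<in> {0<..<1}"
      then show "t \<in> ?g ` {-1<..<1}" by (intro image_eqI [of _ _ "1 - 2 * t"]) auto
    qed
  qed auto
  have deriv: "(?g has_field_derivative - 1 / 2) (at y)" for y
    by (auto intro!: derivative_eq_intros)
  have inj: "inj_on ?g {-1<..<1}"
    by (rule inj_onI) simp
  have pq: "p + 1 > 0" "q + 1 > 0"
    using assms by auto
  note pullback = Beta_integral_pullback [OF pq deriv inj image]
  have "?h integrable_on {-1<..<1}"
    using pullback(1) by (rule set_lebesgue_integral_eq_integral(1))
  then have "(?h has_integral Beta (p + 1) (q + 1)) {-1<..<1}"
    unfolding pullback(2) [symmetric] by (rule integrable_integral)
  then have "((\<lambda>y. 2 powr (p + q + 1) * ?h y) has_integral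
      2 powr (p + q + 1) * Beta (p + 1) (q + 1)) {-1<..<1}"
    by (rule has_integral_mult_right)
  moreover have "2 powr (p + q + 1) * ?h y = (1 - y) powr p * (1 + y) powr q"
    if "y \<in> {-1<..<1}" for y
  proof -
    have *: "1 - ?g y = (1 + y) / 2" by (simp add: field_simps)
    show ?thesis
      unfolding * using that by (simp add: powr_divide powr_add)
  qed
  ultimately have "((\<lambda>y. (1 - y) powr p * (1 + y) powr q) has_integral
      2 powr (p + q + 1) * Beta (p + 1) (q + 1)) {-1<..<1}"
    by (rule has_integral_eq [rotated])
  then show ?thesis
    by (simp add: has_integral_Icc_iff_Ioo)
qed

text \<open>Integration against the weight as a functional on \<open>poly\<close>, so that
  orthogonality becomes polynomial algebra plus linearity.\<close>

definition jacobi_functional :: "real \<Rightarrow> real \<Rightarrow> real poly \<Rightarrow> real" where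
  "jacobi_functional \<alpha> \<beta> p =
     integral {-1..1} (\<lambda>y. (1 - y) powr \<alpha> * (1 + y) powr \<beta> * poly p y)"

lemma jacobi_weight_poly_integrable:
  fixes \<alpha> \<beta> :: real
  assumes "\<alpha> > -1" "\<beta> > -1"
  shows "(\<lambda>y. (1 - y) powr \<alpha> * (1 + y) powr \<beta> * poly p y) integrable_on {-1..1}"
proof -
  have "(\<lambda>y. (1 - y) powr \<alpha> * (1 + y) powr \<beta>) absolutely_integrable_on {-1..1}"
    by (rule nonnegative_absolutely_integrable_1)
       (use has_integral_jacobi_weight [OF assms] in \<open>auto simp: has_integral_integrable\<close>)
  then have "(\<lambda>y. poly p y * ((1 - y) powr \<alpha> * (1 + y) powr \<beta>)) absolutely_integrable_on {-1..1}"
    by (rule absolutely_integrable_bounded_measurable_product_real [rotated -1])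
       (auto intro!: continuous_imp_measurable_on_sets_lebesgue compact_imp_bounded
          compact_continuous_image continuous_intros)
  then show ?thesis
    by (simp add: mult.commute set_lebesgue_integral_eq_integral(1))
qed

section \<open>The Jacobi weight functional: moments, orthogonality, norm\<close>

context
  fixes \<alpha> \<beta> :: real
  assumes \<alpha>: "\<alpha> > -1" and \<beta>: "\<beta> > -1"
begin

lemma jacobi_functional_add:
  "jacobi_functional \<alpha> \<beta> (p + q) = jacobi_functional \<alpha> \<beta> p + jacobi_functional \<alpha> \<beta> q"
  unfolding jacobi_functional_def poly_add ring_distribs
  by (intro integral_add jacobi_weight_poly_integrable \<alpha> \<beta>)

lemma jacobi_functional_smult:
  "jacobi_functional \<alpha> \<beta> (smult c p) = c * jacobi_functional \<alpha> \<beta> p"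
  unfolding jacobi_functional_def poly_smult
  by (simp add: mult.left_commute [of _ c])

lemma jacobi_functional_0: "jacobi_functional \<alpha> \<beta> 0 = 0"
  by (simp add: jacobi_functional_def)

lemma jacobi_functional_sum:
  "jacobi_functional \<alpha> \<beta> (\<Sum>i\<in>I. f i) = (\<Sum>i\<in>I. jacobi_functional \<alpha> \<beta> (f i))"
  by (induction I rule: infinite_finite_induct) (auto simp: jacobi_functional_0 jacobi_functional_add)

text \<open>The two polynomial factors merely shift the exponents of the weight, so the Beta
  integral applies again.\<close>

lemma jacobi_functional_moment:
  "jacobi_functional \<alpha> \<beta> ([:1, -1:] ^ k * [:1, 1:] ^ m) =
     2 powr (\<alpha> + \<beta> + real k + real m + 1) * Beta (\<alpha> + real k + 1) (\<beta> + real m + 1)"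
proof -
  have "((\<lambda>y. (1 - y) powr (\<alpha> + real k) * (1 + y) powr (\<beta> + real m)) has_integral
      2 powr (\<alpha> + real k + (\<beta> + real m) + 1) * Beta (\<alpha> + real k + 1) (\<beta> + real m + 1)) {-1<..<1}"
    using has_integral_jacobi_weight [of "\<alpha> + real k" "\<beta> + real m"] \<alpha> \<beta>
    by (simp add: has_integral_Icc_iff_Ioo)
  moreover have "(1 - y) powr (\<alpha> + real k) * (1 + y) powr (\<beta> + real m) =
      (1 - y) powr \<alpha> * (1 + y) powr \<beta> * poly ([:1, -1:] ^ k * [:1, 1:] ^ m) y"
    if "y \<in> {-1<..<1}" for y
    using that by (simp add: powr_add powr_realpow poly_power)
  ultimately have "((\<lambda>y. (1 - y) powr \<alpha> * (1 + y) powr \<beta> * poly ([:1, -1:] ^ k * [:1, 1:] ^ m) y)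
      has_integral 2 powr (\<alpha> + real k + (\<beta> + real m) + 1) *
        Beta (\<alpha> + real k + 1) (\<beta> + real m + 1)) {-1<..<1}"
    by (rule has_integral_eq [rotated])
  then have "((\<lambda>y. (1 - y) powr \<alpha> * (1 + y) powr \<beta> * poly ([:1, -1:] ^ k * [:1, 1:] ^ m) y)
      has_integral 2 powr (\<alpha> + real k + (\<beta> + real m) + 1) *
        Beta (\<alpha> + real k + 1) (\<beta> + real m + 1)) {-1..1}"
    by (simp add: has_integral_Icc_iff_Ioo)
  from integral_unique [OF this] show ?thesis
    by (simp add: jacobi_functional_def add_ac)
qed

text \<open>Expanding P_n at y = 1 while keeping (1 + y)^m makes every term a Beta moment, and the
  sum over k is Chu--Vandermonde. The value vanishes for m < n and yields the norm for m =
  n.\<close>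

lemma jacobi_functional_jacobi_poly_power:
  "jacobi_functional \<alpha> \<beta> (jacobi_poly n \<alpha> \<beta> * [:1, 1:] ^ m) =
     2 powr (\<alpha> + \<beta> + real m + 1) * Gamma (real n + \<alpha> + 1) * Gamma (\<beta> + real m + 1) / fact n *
     pochhammer (real m + 1 - real n) n * rGamma (\<alpha> + \<beta> + real m + 2 + real n)"
proof -
  let ?K = "2 powr (\<alpha> + \<beta> + real m + 1) * Gamma (real n + \<alpha> + 1) * Gamma (\<beta> + real m + 1) / fact n"
  \<comment> \<open>\<open>?c\<close> comes from the second binomial of P_n, \<open>?d\<close> from
    the denominator Gamma (\<alpha> + \<beta> + k + m + 2) of the Beta moment at k = 0.\<close>
  let ?c = "real n + \<alpha> + \<beta> + 1" and ?d = "\<alpha> + \<beta> + real m + 2"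
  have lin: "[:- 1 / 2, 1 / 2:] = smult (- 1 / 2) [:1, -1 :: real:]" by simp
  have "jacobi_poly n \<alpha> \<beta> * [:1, 1:] ^ m =
      (\<Sum>k\<le>n. smult (((real n + \<alpha>) gchoose (n - k)) * ((real n + \<alpha> + \<beta> + real k) gchoose k) *
                   (- 1 / 2) ^ k) ([:1, -1:] ^ k * [:1, 1:] ^ m))"
    unfolding jacobi_poly_def lin sum_distrib_right
    by (simp only: smult_power smult_smult mult_smult_left)
  then have "jacobi_functional \<alpha> \<beta> (jacobi_poly n \<alpha> \<beta> * [:1, 1:] ^ m) =
      (\<Sum>k\<le>n. ((real n + \<alpha>) gchoose (n - k)) * ((real n + \<alpha> + \<beta> + real k) gchoose k) *
         (- 1 / 2) ^ k * (2 powr (\<alpha> + \<beta> + real k + real m + 1) *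
           Beta (\<alpha> + real k + 1) (\<beta> + real m + 1)))"
    by (simp only: jacobi_functional_sum jacobi_functional_smult jacobi_functional_moment)
  also have "\<dots> = (\<Sum>k\<le>n. ?K * (real (n choose k) * (-1) ^ k * pochhammer ?c k * rGamma (?d + real k)))"
  proof (rule sum.cong [OF refl])
    fix k assume "k \<in> {..n}"
    then have k: "k \<le> n" by simp
    let ?A = "(real n + \<alpha>) gchoose (n - k)"
    have "2 powr (\<alpha> + \<beta> + real k + real m + 1) = 2 ^ k * 2 powr (\<alpha> + \<beta> + real m + 1)"
      by (simp add: powr_add powr_realpow)
    moreover have "(- 1 / 2 :: real) ^ k * 2 ^ k = (-1) ^ k"
      by (simp flip: power_mult_distrib)
    ultimately have pow: "(- 1 / 2) ^ k * 2 powr (\<alpha> + \<beta> + real k + real m + 1) =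
        (-1) ^ k * 2 powr (\<alpha> + \<beta> + real m + 1)"
      by (metis mult.assoc)
    \<comment> \<open>The numerator Gamma of the moment leaves only 1 / (n - k)! of the first
      binomial; with 1 / k! from the second and the n! split off in \<open>?K\<close> this is
      \<open>n choose k\<close>.\<close>
    have A: "Gamma (\<alpha> + real k + 1) * ?A = Gamma (real n + \<alpha> + 1) / fact (n - k)"
      by (rule Gamma_mult_gbinomial_diff [OF \<alpha> k])
    have Bt: "Beta (\<alpha> + real k + 1) (\<beta> + real m + 1) =
        Gamma (\<alpha> + real k + 1) * Gamma (\<beta> + real m + 1) * rGamma (?d + real k)"
      by (simp add: Beta_altdef add_ac)
    have C: "(real n + \<alpha> + \<beta> + real k) gchoose k = pochhammer ?c k / fact k"
      by (rule gbinomial_add_eq_pochhammer)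
    have ch: "real (n choose k) = fact n / (fact k * fact (n - k))"
      using k by (rule binomial_fact)
    have "?A * ((real n + \<alpha> + \<beta> + real k) gchoose k) * (- 1 / 2) ^ k *
        (2 powr (\<alpha> + \<beta> + real k + real m + 1) * Beta (\<alpha> + real k + 1) (\<beta> + real m + 1)) =
      (Gamma (\<alpha> + real k + 1) * ?A) * ((real n + \<alpha> + \<beta> + real k) gchoose k) *
      ((- 1 / 2) ^ k * 2 powr (\<alpha> + \<beta> + real k + real m + 1)) * Gamma (\<beta> + real m + 1) * rGamma (?d + real k)"
      by (simp only: Bt mult_ac)
    also have "\<dots> = ?K * (real (n choose k) * (-1) ^ k * pochhammer ?c k * rGamma (?d + real k))"
      unfolding A C pow ch by (simp add: field_simps)
    finally show "?A * ((real n + \<alpha> + \<beta> + real k) gchoose k) * (- 1 / 2) ^ k *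
        (2 powr (\<alpha> + \<beta> + real k + real m + 1) * Beta (\<alpha> + real k + 1) (\<beta> + real m + 1)) =
        ?K * (real (n choose k) * (-1) ^ k * pochhammer ?c k * rGamma (?d + real k))" .
  qed
  also have "\<dots> = ?K * (pochhammer (?d - ?c) n * rGamma (?d + real n))"
    by (simp only: sum_distrib_left [symmetric] Chu_Vandermonde_rGamma)
  also have "?d - ?c = real m + 1 - real n" by simp
  finally show ?thesis by (simp only: mult.assoc)
qed

text \<open>Expanding in powers of 1 + y makes the orthogonality a zero of a Pochhammer symbol.\<close>

lemma jacobi_poly_orthogonal:
  assumes "degree q < n"
  shows "jacobi_functional \<alpha> \<beta> (jacobi_poly n \<alpha> \<beta> * q) = 0"
proof -
  have "jacobi_functional \<alpha> \<beta> (jacobi_poly n \<alpha> \<beta> * [:1, 1:] ^ m) = 0" if "m < n" for m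
  proof -
    \<comment> \<open>The base is minus a natural number smaller than n, so one of the n factors is
      zero.\<close>
    have "pochhammer (real m + 1 - real n) n = pochhammer (- real (n - m - 1)) n"
      using that by (intro arg_cong2 [of _ _ _ _ pochhammer]) auto
    also have "\<dots> = 0"
      using that by (intro pochhammer_of_nat_eq_0_lemma) auto
    finally show ?thesis
      by (simp add: jacobi_functional_jacobi_poly_power)
  qed
  moreover obtain c where "q = (\<Sum>m\<le>degree q. smult (c m) ([:1, 1:] ^ m))"
    by (rule poly_eq_sum_of_graded_basis [of "degree q" "\<lambda>m. [:1, 1:] ^ m" q]) (auto simp: degree_power_eq)
  then have "jacobi_poly n \<alpha> \<beta> * q =
      (\<Sum>m\<le>degree q. smult (c m) (jacobi_poly n \<alpha> \<beta> * [:1, 1:] ^ m))"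
    by (metis (no_types, lifting) sum_distrib_left mult_smult_right sum.cong)
  then have "jacobi_functional \<alpha> \<beta> (jacobi_poly n \<alpha> \<beta> * q) =
      (\<Sum>m\<le>degree q. c m * jacobi_functional \<alpha> \<beta> (jacobi_poly n \<alpha> \<beta> * [:1, 1:] ^ m))"
    by (simp only: jacobi_functional_smult jacobi_functional_sum)
  ultimately show ?thesis
    using assms by simp
qed

text \<open>One factor is replaced by its leading term in powers of 1 + y; the remainder has degree
  below n and is orthogonal to the other factor.\<close>

lemma jacobi_poly_norm:
  "jacobi_functional \<alpha> \<beta> (jacobi_poly n \<alpha> \<beta> * jacobi_poly n \<alpha> \<beta>) = jacobi_gamma n \<alpha> \<beta>"
proof -
  let ?P = "jacobi_poly n \<alpha> \<beta>" and ?c = "coeff (jacobi_poly n \<alpha> \<beta>) n"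
  define r where "r = ?P - smult ?c ([:1, 1:] ^ n)"
  have lc: "coeff ([:1, 1 :: real:] ^ n) n = 1"
    using lead_coeff_power [of "[:1, 1 :: real:]" n] by (simp add: degree_power_eq)
  then have "coeff r n = 0"
    by (simp add: r_def)
  moreover have "degree r \<le> n"
    unfolding r_def by (intro degree_diff_le)
      (auto simp: degree_jacobi_poly_le degree_power_eq intro: order_trans [OF degree_smult_le])
  ultimately have "r = 0 \<or> degree r < n"
    by (metis leading_coeff_0_iff le_neq_implies_less)
  then have r: "jacobi_functional \<alpha> \<beta> (?P * r) = 0"
    by (auto simp: jacobi_functional_0 jacobi_poly_orthogonal)
  have "?P * ?P = smult ?c (?P * [:1, 1:] ^ n) + ?P * r"
    by (simp add: r_def algebra_simps)
  then have "jacobi_functional \<alpha> \<beta> (?P * ?P) = ?c * jacobi_functional \<alpha> \<beta> (?P * [:1, 1:] ^ n)"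
    by (simp only: jacobi_functional_add jacobi_functional_smult r add_0_right)
  \<comment> \<open>At m = n the Pochhammer symbol is \<open>pochhammer 1 n\<close>, which cancels
    \<open>fact n\<close>.\<close>
  also have "\<dots> = ?c * (2 powr (\<alpha> + \<beta> + real n + 1) * Gamma (real n + \<alpha> + 1) * Gamma (\<beta> + real n + 1) *
      rGamma (\<alpha> + \<beta> + real n + 2 + real n))"
    unfolding jacobi_functional_jacobi_poly_power
    using pochhammer_fact [of n, where 'a = real] by (simp flip: pochhammer_fact)
  also have "?c = pochhammer (real n + \<alpha> + \<beta> + 1) n / fact n / 2 ^ n"
    using gbinomial_add_eq_pochhammer [of "real n + \<alpha> + \<beta>" n]
    by (simp add: coeff_jacobi_poly algebra_simps)
  also have "2 powr (\<alpha> + \<beta> + real n + 1) = 2 ^ n * 2 powr (\<alpha> + \<beta> + 1)"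
    by (simp add: powr_add powr_realpow)
  also have "rGamma (\<alpha> + \<beta> + real n + 2 + real n) = 1 / Gamma (2 * real n + \<alpha> + \<beta> + 2)"
    by (simp add: rGamma_inverse_Gamma field_simps)
  also have "pochhammer (real n + \<alpha> + \<beta> + 1) n / fact n / 2 ^ n * (2 ^ n * 2 powr (\<alpha> + \<beta> + 1) *
      Gamma (real n + \<alpha> + 1) * Gamma (\<beta> + real n + 1) * (1 / Gamma (2 * real n + \<alpha> + \<beta> + 2))) =
      jacobi_gamma n \<alpha> \<beta>"
  \<comment> \<open>For n = 0 the general denominator would contain (\<alpha> + \<beta> + 1) Gamma
    (\<alpha> + \<beta> + 1), which breaks down at \<alpha> + \<beta> = -1; hence the separate
    clause of \<open>jacobi_gamma\<close>. For n > 0 the argument s is positive.\<close>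
  proof (cases "n = 0")
    case True
    then show ?thesis by (simp add: jacobi_gamma_def)
  next
    case False
    define s where "s = real n + \<alpha> + \<beta> + 1"
    have s: "s > 0" using False \<alpha> \<beta> by (simp add: s_def Suc_le_eq [symmetric] flip: One_nat_def)
    have "pochhammer s n = Gamma (s + real n) / Gamma s"
      using s by (intro pochhammer_Gamma) (auto elim!: nonpos_Ints_cases)
    moreover have "Gamma (s + real n + 1) = (s + real n) * Gamma (s + real n)"
      using s by (intro Gamma_plus1) (auto elim!: nonpos_Ints_cases)
    moreover have e: "2 * real n + \<alpha> + \<beta> + 2 = s + real n + 1" "2 * real n + \<alpha> + \<beta> + 1 = s + real n"
      by (simp_all add: s_def)
    moreover have "Gamma s \<noteq> 0" "Gamma (s + real n) \<noteq> 0"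
      using s by (auto simp: Gamma_eq_zero_iff elim!: nonpos_Ints_cases)
    ultimately show ?thesis
      using False s unfolding jacobi_gamma_def s_def [symmetric] e
      by (simp add: add.commute [of "real n" \<beta>] mult_ac)
  qed
  finally show ?thesis .
qed

text \<open>Strictness comes from the middle interval [-1/2, 1/2]: there the integrand is continuous
  and the weight positive, so a zero integral would give p infinitely many roots.\<close>

lemma jacobi_functional_pos:
  assumes "p \<noteq> 0" and nonneg: "\<And>y. y \<in> {-1<..<1} \<Longrightarrow> poly p y \<ge> 0"
  shows "jacobi_functional \<alpha> \<beta> p > 0"
proof -
  let ?f = "\<lambda>y. (1 - y) powr \<alpha> * (1 + y) powr \<beta> * poly p y"
  \<comment> \<open>At y = -1 and y = 1 nothing is known about p, but \<open>0 powr a = 0\<close>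
    makes the integrand zero.\<close>
  have f: "?f y \<ge> 0" if "y \<in> {-1..1}" for y
    using nonneg [of y] that by (cases "y \<in> {-1<..<1}") auto
  have cont: "continuous_on {-1/2..1/2} ?f"
    by (intro continuous_intros) auto
  have "integral {-1/2..1/2} ?f \<noteq> 0"
  proof
    assume "integral {-1/2..1/2} ?f = 0"
    then have "\<forall>y\<in>{-1/2..1/2}. ?f y = 0"
      using f by (subst (asm) integral_eq_0_iff [OF cont]) auto
    then have "{-1/2..1/2} \<subseteq> {y. poly p y = 0}" by auto
    moreover have "finite {y. poly p y = 0}"
      using \<open>p \<noteq> 0\<close> by (rule poly_roots_finite)
    ultimately have "finite {-1/2..1/2 :: real}"
      by (rule finite_subset)
    moreover have "infinite {-1/2..1/2 :: real}"
      by (rule infinite_Icc) simp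
    ultimately show False by contradiction
  qed
  moreover have "integral {-1/2..1/2} ?f \<ge> 0"
    using f by (intro integral_nonneg integrable_continuous_interval cont) auto
  moreover have "integral {-1/2..1/2} ?f \<le> integral {-1..1} ?f"
    using f by (intro integral_subset_le integrable_continuous_interval cont
        jacobi_weight_poly_integrable \<alpha> \<beta>) auto
  ultimately show ?thesis
    by (simp add: jacobi_functional_def)
qed

section \<open>Zeros of the Jacobi polynomials and the Gauss rule\<close>

lemma jacobi_poly_nonzero: "jacobi_poly n \<alpha> \<beta> \<noteq> 0"
  using coeff_jacobi_poly_pos [OF \<alpha> \<beta>, of n] by auto

text \<open>With fewer than n elements in Z, the product of P_n and the factors over Z would have
  constant sign and hence a nonzero integral, against orthogonality. So n distinct zeros lie in the
  open interval, and the degree leaves room for no others.\<close>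

lemma jacobi_poly_roots:
  shows "card {y. poly (jacobi_poly n \<alpha> \<beta>) y = 0} = n"
    and "{y. poly (jacobi_poly n \<alpha> \<beta>) y = 0} \<subseteq> {-1<..<1}"
proof -
  let ?P = "jacobi_poly n \<alpha> \<beta>"
  let ?R = "{y. poly ?P y = 0}"
  obtain Z where Z: "Z \<subseteq> ?R" "Z \<subseteq> {-1<..<1}"
    and sign: "(\<forall>y\<in>{-1<..<1}. poly (?P * (\<Prod>z\<in>Z. [:- z, 1:])) y \<ge> 0) \<or>
     (\<forall>y\<in>{-1<..<1}. poly (?P * (\<Prod>z\<in>Z. [:- z, 1:])) y \<le> 0)"
    using poly_constant_sign_factor [OF jacobi_poly_nonzero] by blast
  let ?q = "\<Prod>z\<in>Z. [:- z, 1:]"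
  have fin: "finite ?R"
    by (rule poly_roots_finite) (rule jacobi_poly_nonzero)
  have "finite Z"
    using Z(1) fin by (rule finite_subset)
  then have q: "?q \<noteq> 0" "degree ?q = card Z"
    by (auto simp: degree_prod_eq_sum_degree)
  have "n \<le> card Z"
  proof (rule ccontr)
    assume "\<not> n \<le> card Z"
    then have 0: "jacobi_functional \<alpha> \<beta> (?P * ?q) = 0"
      using q by (intro jacobi_poly_orthogonal) simp
    have "?P * ?q \<noteq> 0" using q jacobi_poly_nonzero by simp
    with sign have "jacobi_functional \<alpha> \<beta> (?P * ?q) > 0 \<or>
        jacobi_functional \<alpha> \<beta> (smult (-1) (?P * ?q)) > 0"
      using jacobi_functional_pos [of "?P * ?q"] jacobi_functional_pos [of "smult (-1) (?P * ?q)"]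
      by auto
    with 0 show False
      by (simp only: jacobi_functional_smult) simp
  qed
  moreover have "card ?R \<le> n"
    using card_poly_roots_bound [OF jacobi_poly_nonzero] degree_jacobi_poly [OF \<alpha> \<beta>] by metis
  moreover have "card Z \<le> card ?R"
    using fin Z(1) by (rule card_mono)
  ultimately have "card Z = card ?R" and "card ?R = n" by auto
  then show "card ?R = n" and "?R \<subseteq> {-1<..<1}"
    using card_subset_eq [OF fin Z(1)] Z(2) by auto
qed

text \<open>The zeros are N + 1 distinct numbers, so the sorted list is long enough for every index
  up to N.\<close>

lemma bij_betw_gauss_jacobi_node:
  "bij_betw (gauss_jacobi_node N \<alpha> \<beta>) {..N} {y. poly (jacobi_poly (N + 1) \<alpha> \<beta>) y = 0}"
proof -
  let ?R = "{y. poly (jacobi_poly (N + 1) \<alpha> \<beta>) y = 0}"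
  have "finite ?R" by (rule poly_roots_finite) (rule jacobi_poly_nonzero)
  moreover have "length (sorted_list_of_set ?R) = N + 1"
    using jacobi_poly_roots(1) [of "N + 1"] by simp
  ultimately have "bij_betw ((!) (sorted_list_of_set ?R)) {..N} ?R"
    by (intro bij_betw_nth) auto
  then show ?thesis
    by (simp add: gauss_jacobi_node_def [abs_def])
qed

lemma gauss_jacobi_node_bounds:
  assumes "r \<le> N"
  shows "gauss_jacobi_node N \<alpha> \<beta> r \<in> {-1<..<1}"
  using bij_betwE [OF bij_betw_gauss_jacobi_node] jacobi_poly_roots(2) [of "N + 1"] assms by blast

lemma inj_on_gauss_jacobi_node: "inj_on (gauss_jacobi_node N \<alpha> \<beta>) {..N}"
  using bij_betw_gauss_jacobi_node by (rule bij_betw_imp_inj_on)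

lemma gauss_jacobi_weight_eq_functional:
  "gauss_jacobi_weight N \<alpha> \<beta> i =
     jacobi_functional \<alpha> \<beta> (lagrange_basis_poly N (gauss_jacobi_node N \<alpha> \<beta>) i)"
  by (simp add: gauss_jacobi_weight_def jacobi_functional_def poly_lagrange_basis_poly)

text \<open>A product of degree at most 2N vanishing at all nodes is the nodal polynomial times a
  polynomial of degree below N + 1, to which the nodal polynomial is orthogonal.\<close>

lemma jacobi_functional_lagrange_basis_mult:
  assumes "degree q \<le> N" "i \<le> N"
  shows "jacobi_functional \<alpha> \<beta> (lagrange_basis_poly N (gauss_jacobi_node N \<alpha> \<beta>) i * q) =
           gauss_jacobi_weight N \<alpha> \<beta> i * poly q (gauss_jacobi_node N \<alpha> \<beta> i)"
proof -
  let ?y = "gauss_jacobi_node N \<alpha> \<beta>" and ?P = "jacobi_poly (N + 1) \<alpha> \<beta>"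
  let ?l = "lagrange_basis_poly N ?y i"
  \<comment> \<open>Both parts of r take the same values at the nodes, since the basis polynomial is
    1 at node i and 0 at the others.\<close>
  define r where "r = ?l * q - smult (poly q (?y i)) ?l"
  have degl: "degree ?l \<le> N"
    by (rule degree_lagrange_basis_poly_le [OF assms(2)])
  have degP: "degree ?P = N + 1"
    by (rule degree_jacobi_poly [OF \<alpha> \<beta>])
  have degr: "degree r \<le> N + N"
    unfolding r_def using degl assms(1)
    by (intro degree_diff_le order_trans [OF degree_mult_le] order_trans [OF degree_smult_le]) auto
  have r0: "poly r (?y j) = 0" if "j \<le> N" for j
    using poly_lagrange_basis_poly_node [OF inj_on_gauss_jacobi_node assms(2) that]
    by (auto simp: r_def split: if_splits)
  have P0: "poly ?P (?y j) = 0" if "j \<le> N" for j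
    using bij_betwE [OF bij_betw_gauss_jacobi_node] that by blast
  \<comment> \<open>A nonzero remainder would have degree at most N but N + 1 zeros.\<close>
  have "r mod ?P = 0"
  proof (rule ccontr)
    assume nz: "r mod ?P \<noteq> 0"
    then have "degree (r mod ?P) < N + 1"
      using degree_mod_less [OF jacobi_poly_nonzero, of r "N + 1"] degP by auto
    moreover have "?y ` {..N} \<subseteq> {t. poly (r mod ?P) t = 0}"
      using r0 P0 by (auto simp: poly_mod)
    then have "card (?y ` {..N}) \<le> card {t. poly (r mod ?P) t = 0}"
      by (rule card_mono [OF poly_roots_finite [OF nz]])
    then have "N + 1 \<le> card {t. poly (r mod ?P) t = 0}"
      by (simp add: card_image inj_on_gauss_jacobi_node)
    ultimately show False
      using card_poly_roots_bound [OF nz] by simp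
  qed
  then obtain k where k: "r = ?P * k"
    by (metis dvdE mod_0_imp_dvd)
  have "jacobi_functional \<alpha> \<beta> r = 0"
  proof (cases "k = 0")
    case True
    then show ?thesis by (simp add: k jacobi_functional_0)
  next
    case False
    \<comment> \<open>As r has degree at most 2N, the cofactor k has degree below N + 1.\<close>
    then have "degree r = N + 1 + degree k"
      using k degP jacobi_poly_nonzero by (simp add: degree_mult_eq)
    with degr show ?thesis
      unfolding k by (intro jacobi_poly_orthogonal) simp
  qed
  moreover have "?l * q = r + smult (poly q (?y i)) ?l"
    by (simp add: r_def)
  ultimately show ?thesis
    by (simp add: jacobi_functional_add jacobi_functional_smult gauss_jacobi_weight_eq_functional)
qed

text \<open>Read off from the norm, which avoids a sign analysis of the Gamma factors.\<close>

lemma jacobi_gamma_pos: "jacobi_gamma n \<alpha> \<beta> > 0"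
  unfolding jacobi_poly_norm [symmetric]
  by (rule jacobi_functional_pos) (simp_all add: jacobi_poly_nonzero)

lemma jacobi_functional_jacobi_poly_mult:
  "jacobi_functional \<alpha> \<beta> (jacobi_poly j \<alpha> \<beta> * jacobi_poly m \<alpha> \<beta>) =
     (if j = m then jacobi_gamma m \<alpha> \<beta> else 0)"
proof (cases j m rule: linorder_cases)
  case less
  then have "jacobi_functional \<alpha> \<beta> (jacobi_poly m \<alpha> \<beta> * jacobi_poly j \<alpha> \<beta>) = 0"
    by (intro jacobi_poly_orthogonal) (simp add: degree_jacobi_poly \<alpha> \<beta>)
  with less show ?thesis by (simp add: mult.commute)
next
  case equal
  then show ?thesis by (simp add: jacobi_poly_norm)
next
  case greater
  then have "jacobi_functional \<alpha> \<beta> (jacobi_poly j \<alpha> \<beta> * jacobi_poly m \<alpha> \<beta>) = 0"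
    by (intro jacobi_poly_orthogonal) (simp add: degree_jacobi_poly \<alpha> \<beta>)
  with greater show ?thesis by simp
qed

lemma lagrange_basis_poly_jacobi_expansion:
  assumes "i \<le> N"
  shows "lagrange_basis_poly N (gauss_jacobi_node N \<alpha> \<beta>) i =
    (\<Sum>j\<le>N. smult (gauss_jacobi_weight N \<alpha> \<beta> i / jacobi_gamma j \<alpha> \<beta> *
                     poly (jacobi_poly j \<alpha> \<beta>) (gauss_jacobi_node N \<alpha> \<beta> i)) (jacobi_poly j \<alpha> \<beta>))"
proof -
  let ?l = "lagrange_basis_poly N (gauss_jacobi_node N \<alpha> \<beta>) i"
  obtain c where c: "?l = (\<Sum>j\<le>N. smult (c j) (jacobi_poly j \<alpha> \<beta>))"
    by (rule poly_eq_sum_of_graded_basis [of N "\<lambda>j. jacobi_poly j \<alpha> \<beta>" ?l])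
       (simp_all add: degree_jacobi_poly \<alpha> \<beta> jacobi_poly_nonzero degree_lagrange_basis_poly_le assms)
  have "c m = gauss_jacobi_weight N \<alpha> \<beta> i / jacobi_gamma m \<alpha> \<beta> *
      poly (jacobi_poly m \<alpha> \<beta>) (gauss_jacobi_node N \<alpha> \<beta> i)" if "m \<le> N" for m
  proof -
    have "gauss_jacobi_weight N \<alpha> \<beta> i * poly (jacobi_poly m \<alpha> \<beta>) (gauss_jacobi_node N \<alpha> \<beta> i) =
        jacobi_functional \<alpha> \<beta> (?l * jacobi_poly m \<alpha> \<beta>)"
      by (rule jacobi_functional_lagrange_basis_mult [symmetric])
         (simp_all add: degree_jacobi_poly \<alpha> \<beta> assms that)
    also have "\<dots> = (\<Sum>j\<le>N. c j * (if j = m then jacobi_gamma m \<alpha> \<beta> else 0))"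
      unfolding c sum_distrib_right mult_smult_left jacobi_functional_sum jacobi_functional_smult
        jacobi_functional_jacobi_poly_mult ..
    also have "\<dots> = c m * jacobi_gamma m \<alpha> \<beta>"
      using that by (simp add: if_distrib cong: if_cong)
    finally show ?thesis
      using jacobi_gamma_pos [of m] by (simp add: field_simps)
  qed
  with c show ?thesis by simp
qed

end

section \<open>Erdelyi--Kober derivatives of power sums\<close>

text \<open>The factor \<open>\<sigma> * t powr (\<sigma> - 1)\<close> is the Jacobian of
  \<open>t powr \<sigma>\<close>, so this is the Riemann--Liouville integral of (B - X)^e. Rescaling
  the interval from X to B to unit length reduces it to a Beta integral.\<close>

lemma powr_Riemann_Liouville_integral:
  fixes b z \<sigma> \<nu> e :: real
  assumes "0 < z" "z < b" "\<sigma> > 0" "\<nu> > 0" "e > -1"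
  defines "h \<equiv> \<lambda>t. \<sigma> * t powr (\<sigma> - 1) * (t powr \<sigma> - z powr \<sigma>) powr (\<nu> - 1) * (b powr \<sigma> - t powr \<sigma>) powr e"
  shows "h absolutely_integrable_on {z..b}"
    and "integral {z..b} h =
           Gamma \<nu> * Gamma (e + 1) * rGamma (e + 1 + \<nu>) * (b powr \<sigma> - z powr \<sigma>) powr (e + \<nu>)"
proof -
  let ?B = "b powr \<sigma>" and ?X = "z powr \<sigma>"
  let ?D = "?B - ?X"
  have D: "?D > 0"
    using assms by (simp add: powr_less_mono2)
  let ?g = "\<lambda>t. (t powr \<sigma> - ?X) / ?D" and ?g' = "\<lambda>t. \<sigma> * t powr (\<sigma> - 1) / ?D"
  have mono: "s powr \<sigma> < t powr \<sigma>" if "0 < s" "s < t" for s t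
    using that assms by (intro powr_less_mono2) auto
  have deriv: "(?g has_field_derivative ?g' t) (at t)" if "t \<in> {z<..<b}" for t
    using that assms(1) D by (auto intro!: derivative_eq_intros)
  have inj: "inj_on ?g {z<..<b}"
  proof (rule linorder_inj_onI)
    fix s t assume "s < t" "s \<in> {z<..<b}" "t \<in> {z<..<b}"
    then have "s powr \<sigma> < t powr \<sigma>"
      using assms(1) by (intro mono) auto
    then show "?g s \<noteq> ?g t"
      using D by simp
  qed auto
  have image: "?g ` {z<..<b} = {0<..<1}"
  proof (intro subset_antisym subsetI)
    fix s assume "s \<in> ?g ` {z<..<b}"
    then obtain t where t: "z < t" "t < b" "s = ?g t" by auto
    have "?X < t powr \<sigma>" "t powr \<sigma> < ?B"
      using t assms by (auto intro!: mono)
    then show "s \<in> {0<..<1}"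
      using D by (simp add: t(3))
  next
    fix s :: real assume s: "s \<in> {0<..<1}"
    define t where "t = (?X + s * ?D) powr (1 / \<sigma>)"
    have "0 < ?X" using assms by simp
    have "s * ?D < 1 * ?D" by (intro mult_strict_right_mono) (use s D in auto)
    moreover have "s * ?D > 0" using s D by simp
    ultimately have "?X < ?X + s * ?D" "?X + s * ?D < ?B" by auto
    then have "?X powr (1 / \<sigma>) < t" "t < ?B powr (1 / \<sigma>)"
      using \<open>0 < ?X\<close> assms unfolding t_def by (auto intro!: powr_less_mono2)
    then have "t \<in> {z<..<b}"
      using assms by (simp add: powr_powr)
    moreover have "t powr \<sigma> = ?X + s * ?D"
      using assms \<open>0 < ?X\<close> \<open>s * ?D > 0\<close> by (simp add: t_def powr_powr)
    then have "s = ?g t" using D by simp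
    ultimately show "s \<in> ?g ` {z<..<b}" by blast
  qed
  have "e + 1 > 0" using assms by simp
  let ?k = "\<lambda>t. \<bar>?g' t\<bar> * (?g t powr (\<nu> - 1) * (1 - ?g t) powr (e + 1 - 1))"
  have k: "?k absolutely_integrable_on {z<..<b}" "integral {z<..<b} ?k = Beta \<nu> (e + 1)"
    by (rule Beta_integral_pullback [OF \<open>\<nu> > 0\<close> \<open>e + 1 > 0\<close> deriv inj image], assumption)+
  have "(?k has_integral Beta \<nu> (e + 1)) {z<..<b}"
    unfolding k(2) [symmetric]
    by (intro integrable_integral set_lebesgue_integral_eq_integral(1) k(1))
  \<comment> \<open>The power of \<open>?D\<close> undoes the rescaling: exponents \<nu> - 1 and e
    from the two factors and 1 from \<open>?g'\<close>.\<close>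
  then have "((\<lambda>t. ?D powr (e + \<nu>) * ?k t) has_integral ?D powr (e + \<nu>) * Beta \<nu> (e + 1)) {z<..<b}"
    by (rule has_integral_mult_right)
  moreover have "?D powr (e + \<nu>) * ?k t = h t" if "t \<in> {z<..<b}" for t
  proof -
    have "?X < t powr \<sigma>" "t powr \<sigma> < ?B"
      using that assms by (auto intro!: mono)
    then have g: "?g t powr (\<nu> - 1) = (t powr \<sigma> - ?X) powr (\<nu> - 1) / ?D powr (\<nu> - 1)"
      and g1: "(1 - ?g t) powr e = (?B - t powr \<sigma>) powr e / ?D powr e"
      using D by (simp_all add: powr_divide [symmetric] field_simps)
    have "?D powr (e + \<nu>) = ?D powr e * ?D powr (\<nu> - 1) * ?D"
      using D powr_add [of ?D "\<nu> - 1" 1] by (simp add: powr_add)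
    then show ?thesis
      using D assms by (simp add: h_def g g1 abs_mult)
  qed
  ultimately have "(h has_integral ?D powr (e + \<nu>) * Beta \<nu> (e + 1)) {z<..<b}"
    by (rule has_integral_eq [rotated])
  then have h: "(h has_integral ?D powr (e + \<nu>) * Beta \<nu> (e + 1)) {z..b}"
    by (simp add: has_integral_Icc_iff_Ioo)
  then show "h absolutely_integrable_on {z..b}"
    using assms(3) by (intro nonnegative_absolutely_integrable_1) (auto simp: h_def has_integral_integrable)
  show "integral {z..b} h = Gamma \<nu> * Gamma (e + 1) * rGamma (e + 1 + \<nu>) * ?D powr (e + \<nu>)"
    using integral_unique [OF h] by (simp add: Beta_altdef add_ac)
qed

text \<open>In the application \<open>I\<close> consists of pairs (j, k) and the exponents are
  \<alpha> + k. The formula for f is asked for only inside the interval, because a single value at b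
  does not affect the integrals.\<close>

locale EK_power_sum =
  fixes b \<sigma> \<eta> :: real and I :: "'i set" and c e :: "'i \<Rightarrow> real" and f :: "real \<Rightarrow> real"
  assumes \<sigma>: "\<sigma> > 0" and finite_I: "finite I" and e: "i \<in> I \<Longrightarrow> e i > -1"
    and f: "t \<in> {0<..<b} \<Longrightarrow>
      f t = t powr (\<sigma> * \<eta>) * (\<Sum>i\<in>I. c i * (b powr \<sigma> - t powr \<sigma>) powr e i)"
begin

text \<open>The parameter is \<eta> - \<nu> because the derivative calls the integral with \<eta> +
  \<mu> - n, where \<nu> = n - \<mu>. The powers of t then combine to
  \<open>t powr (\<sigma> - 1)\<close>; dividing by \<sigma> in the coefficients completes the
  Jacobian.\<close>

lemma EK_integrand:
  assumes "\<nu> > 0" "z \<in> {0<..<b}"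
  shows "EK_integrand \<sigma> (\<eta> - \<nu>) \<nu> f z absolutely_integrable_on {z..b}"
    and "integral {z..b} (EK_integrand \<sigma> (\<eta> - \<nu>) \<nu> f z) =
      (\<Sum>i\<in>I. c i / \<sigma> * (Gamma \<nu> * Gamma (e i + 1) * rGamma (e i + 1 + \<nu>) *
         (b powr \<sigma> - z powr \<sigma>) powr (e i + \<nu>)))"
proof -
  let ?h = "\<lambda>i t. \<sigma> * t powr (\<sigma> - 1) * (t powr \<sigma> - z powr \<sigma>) powr (\<nu> - 1) *
    (b powr \<sigma> - t powr \<sigma>) powr e i"
  let ?s = "\<lambda>t. \<Sum>i\<in>I. c i / \<sigma> * ?h i t"
  have z: "0 < z" "z < b" using assms by auto
  note RL = powr_Riemann_Liouville_integral [OF z \<sigma> \<open>\<nu> > 0\<close> e]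
  have s: "?s absolutely_integrable_on {z..b}"
    by (intro absolutely_integrable_sum finite_I set_integrable_mult_right RL(1))
  have int_s: "integral {z..b} ?s =
      (\<Sum>i\<in>I. c i / \<sigma> * (Gamma \<nu> * Gamma (e i + 1) * rGamma (e i + 1 + \<nu>) *
         (b powr \<sigma> - z powr \<sigma>) powr (e i + \<nu>)))"
  proof -
    have "integral {z..b} ?s = (\<Sum>i\<in>I. integral {z..b} (\<lambda>t. c i / \<sigma> * ?h i t))"
      by (intro integral_sum finite_I set_lebesgue_integral_eq_integral(1)
          set_integrable_mult_right RL(1))
    also have "\<dots> = (\<Sum>i\<in>I. c i / \<sigma> * integral {z..b} (?h i))"
      by (intro sum.cong refl integral_mult_right)
    finally show ?thesis by (simp add: RL(2))
  qed
  have eq: "EK_integrand \<sigma> (\<eta> - \<nu>) \<nu> f z t = ?s t" if "t \<in> {z..b} - {z, b}" for t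
  proof -
    have t: "t \<in> {0<..<b}" using that z by auto
    have exponents: "t powr (- \<sigma> * (\<eta> - \<nu> + \<nu> - 1) - 1) * t powr (\<sigma> * \<eta>) = t powr (\<sigma> - 1)"
      using t by (simp add: powr_add [symmetric] algebra_simps)
    have "EK_integrand \<sigma> (\<eta> - \<nu>) \<nu> f z t = (t powr \<sigma> - z powr \<sigma>) powr (\<nu> - 1) *
        (t powr (- \<sigma> * (\<eta> - \<nu> + \<nu> - 1) - 1) * t powr (\<sigma> * \<eta>)) *
        (\<Sum>i\<in>I. c i * (b powr \<sigma> - t powr \<sigma>) powr e i)"
      unfolding EK_integrand_def f [OF t] by (simp only: mult.assoc)
    also have "\<dots> = ?s t"
      unfolding exponents sum_distrib_left
      using \<sigma> by (intro sum.cong refl) simp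
    finally show ?thesis .
  qed
  show "EK_integrand \<sigma> (\<eta> - \<nu>) \<nu> f z absolutely_integrable_on {z..b}"
    by (rule absolutely_integrable_spike [OF s negligible_finite [of "{z, b}"]]) (use eq in auto)
  show "integral {z..b} (EK_integrand \<sigma> (\<eta> - \<nu>) \<nu> f z) =
      (\<Sum>i\<in>I. c i / \<sigma> * (Gamma \<nu> * Gamma (e i + 1) * rGamma (e i + 1 + \<nu>) *
         (b powr \<sigma> - z powr \<sigma>) powr (e i + \<nu>)))"
    unfolding int_s [symmetric]
    by (rule integral_spike [OF negligible_finite [of "{z, b}"]]) (use eq in auto)
qed

text \<open>The outer power of z cancels the one in front of the integral. What remains is a pure
  power sum, in which each power carries the \<open>rGamma\<close> factor that the differential
  operator reproduces.\<close>

lemma EK_inner_eq: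
  assumes "\<mu> > 0" "z \<in> {0<..<b}"
  shows "EK_inner b \<sigma> \<eta> \<mu> f z =
    (\<Sum>i\<in>I. c i * Gamma (e i + 1) * rGamma (e i + real (nat \<lceil>\<mu>\<rceil>) - \<mu> + 1) *
       (b powr \<sigma> - z powr \<sigma>) powr (e i + real (nat \<lceil>\<mu>\<rceil>) - \<mu>))"
proof -
  define n where "n = nat \<lceil>\<mu>\<rceil>"
  define \<nu> where "\<nu> = real n - \<mu>"
  have "\<nu> \<ge> 0" using assms by (simp add: \<nu>_def n_def)
  have \<eta>: "\<eta> + \<mu> - real n = \<eta> - \<nu>" by (simp add: \<nu>_def)
  have "- \<sigma> * (\<mu> + \<eta> - real n) = - (\<sigma> * (\<eta> - \<nu>))"
    by (simp add: \<nu>_def algebra_simps)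
  then have cancel: "z powr (- \<sigma> * (\<mu> + \<eta> - real n)) * z powr (\<sigma> * (\<eta> - \<nu>)) = 1"
    using assms(2) by (simp only: powr_minus) simp
  have *: "z powr (- \<sigma> * (\<mu> + \<eta> - real n)) * EK_integral b \<sigma> (\<eta> - \<nu>) \<nu> f z =
    (\<Sum>i\<in>I. c i * Gamma (e i + 1) * rGamma (e i + 1 + \<nu>) * (b powr \<sigma> - z powr \<sigma>) powr (e i + \<nu>))"
  \<comment> \<open>This is the case of an integer \<mu>, where the integral is the identity by
    convention. The same formula results because Gamma (e + 1) and its reciprocal cancel for e >
    -1.\<close>
  proof (cases "\<nu> = 0")
    case True
    then have "z powr (- \<sigma> * (\<mu> + \<eta> - real n)) * z powr (\<sigma> * \<eta>) = 1"
      using cancel by (simp only: diff_0_right)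
    then have "z powr (- \<sigma> * (\<mu> + \<eta> - real n)) * f z =
        (\<Sum>i\<in>I. c i * (b powr \<sigma> - z powr \<sigma>) powr e i)"
      unfolding f [OF assms(2)] mult.assoc [symmetric] by (simp only: mult_1_left)
    also have "\<dots> = (\<Sum>i\<in>I. c i * Gamma (e i + 1) * rGamma (e i + 1) * (b powr \<sigma> - z powr \<sigma>) powr e i)"
    proof (rule sum.cong [OF refl])
      fix i assume "i \<in> I"
      then have "Gamma (e i + 1) > 0" using e by (intro Gamma_real_pos) fastforce
      then show "c i * (b powr \<sigma> - z powr \<sigma>) powr e i =
          c i * Gamma (e i + 1) * rGamma (e i + 1) * (b powr \<sigma> - z powr \<sigma>) powr e i"
        by (simp add: rGamma_inverse_Gamma)
    qed
    finally show ?thesis by (simp add: EK_integral_def True)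
  next
    case False
    with \<open>\<nu> \<ge> 0\<close> have "\<nu> > 0" by simp
    then have G: "Gamma \<nu> > 0" by (rule Gamma_real_pos)
    have "z powr (- \<sigma> * (\<mu> + \<eta> - real n)) * EK_integral b \<sigma> (\<eta> - \<nu>) \<nu> f z =
        z powr (- \<sigma> * (\<mu> + \<eta> - real n)) * z powr (\<sigma> * (\<eta> - \<nu>)) *
        (\<sigma> / Gamma \<nu> * integral {z..b} (EK_integrand \<sigma> (\<eta> - \<nu>) \<nu> f z))"
      using False by (simp add: EK_integral_def)
    also have "\<dots> = \<sigma> / Gamma \<nu> * integral {z..b} (EK_integrand \<sigma> (\<eta> - \<nu>) \<nu> f z)"
      by (simp only: cancel mult_1_left)
    also have "\<dots> = (\<Sum>i\<in>I. c i * Gamma (e i + 1) * rGamma (e i + 1 + \<nu>) *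
        (b powr \<sigma> - z powr \<sigma>) powr (e i + \<nu>))"
      unfolding EK_integrand(2) [OF \<open>\<nu> > 0\<close> assms(2)] sum_distrib_left
      using \<sigma> G by (intro sum.cong refl) (simp add: field_simps)
    finally show ?thesis .
  qed
  have "e i + 1 + \<nu> = e i + real n - \<mu> + 1" "e i + \<nu> = e i + real n - \<mu>" for i
    by (simp_all add: \<nu>_def)
  with * show ?thesis
    unfolding EK_inner_def Let_def n_def [symmetric] \<eta> by (simp only: \<nu>_def)
qed

end

text \<open>In X = \<open>t powr \<sigma>\<close> the operator is -d/dX, which sends (B - X)^e to e
  (B - X)^(e - 1); the factor e is absorbed by \<open>rGamma_plus1\<close>. This also covers e = 0,
  where the term is constant and \<open>rGamma 0 = 0\<close>.\<close>

lemma EK_diff_op_power_sum: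
  fixes b \<sigma> :: real and c e :: "'i \<Rightarrow> real"
  assumes "\<sigma> > 0" "finite I" "z \<in> {0<..<b}"
    and g: "\<And>t. t \<in> {0<..<b} \<Longrightarrow> g t = (\<Sum>i\<in>I. c i * rGamma (e i + 1) * (b powr \<sigma> - t powr \<sigma>) powr e i)"
  shows "g field_differentiable at z"
    and "EK_diff_op \<sigma> g z = (\<Sum>i\<in>I. c i * rGamma (e i) * (b powr \<sigma> - z powr \<sigma>) powr (e i - 1))"
proof -
  let ?d = "- (\<sigma> * z powr (\<sigma> - 1))"
  have pos: "b powr \<sigma> - z powr \<sigma> > 0" "z > 0"
    using assms by (auto simp: powr_less_mono2)
  have "((\<lambda>t. \<Sum>i\<in>I. c i * rGamma (e i + 1) * (b powr \<sigma> - t powr \<sigma>) powr e i) has_field_derivative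
      (\<Sum>i\<in>I. c i * rGamma (e i + 1) * (?d * (e i * (b powr \<sigma> - z powr \<sigma>) powr (e i - 1))))) (at z)"
    using pos by (intro DERIV_sum DERIV_cmult) (auto intro!: derivative_eq_intros)
  \<comment> \<open>The formula for g holds only on an open set around z, so the derivative is
    transferred by local agreement.\<close>
  moreover have "eventually (\<lambda>t. t \<in> {0<..<b}) (nhds z)"
    using assms(3) by (intro eventually_nhds_in_open) auto
  then have "eventually (\<lambda>t. g t = (\<Sum>i\<in>I. c i * rGamma (e i + 1) * (b powr \<sigma> - t powr \<sigma>) powr e i)) (nhds z)"
    by (rule eventually_mono) (rule g)
  ultimately have D: "(g has_field_derivative
      (\<Sum>i\<in>I. c i * rGamma (e i + 1) * (?d * (e i * (b powr \<sigma> - z powr \<sigma>) powr (e i - 1))))) (at z)"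
    by (subst DERIV_cong_ev [OF refl _ refl])
  then show "g field_differentiable at z"
    by (auto simp: field_differentiable_def)
  have "(\<Sum>i\<in>I. c i * rGamma (e i + 1) * (?d * (e i * (b powr \<sigma> - z powr \<sigma>) powr (e i - 1)))) =
      ?d * (\<Sum>i\<in>I. c i * (e i * rGamma (e i + 1)) * (b powr \<sigma> - z powr \<sigma>) powr (e i - 1))"
    unfolding sum_distrib_left by (intro sum.cong refl) (simp only: mult_ac)
  then show "EK_diff_op \<sigma> g z = (\<Sum>i\<in>I. c i * rGamma (e i) * (b powr \<sigma> - z powr \<sigma>) powr (e i - 1))"
    using \<open>\<sigma> > 0\<close> pos unfolding EK_diff_op_def DERIV_imp_deriv [OF D] rGamma_plus1 by simp
qed

lemma EK_diff_op_funpow_power_sum: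
  fixes b \<sigma> :: real and c e :: "'i \<Rightarrow> real"
  assumes "\<sigma> > 0" "finite I"
    and g: "\<And>t. t \<in> {0<..<b} \<Longrightarrow> g t = (\<Sum>i\<in>I. c i * rGamma (e i + 1) * (b powr \<sigma> - t powr \<sigma>) powr e i)"
    and "z \<in> {0<..<b}"
  shows "(EK_diff_op \<sigma> ^^ k) g z =
    (\<Sum>i\<in>I. c i * rGamma (e i - real k + 1) * (b powr \<sigma> - z powr \<sigma>) powr (e i - real k))"
  using \<open>z \<in> {0<..<b}\<close>
\<comment> \<open>The next differentiation needs the formula at all points of the interval, hence
  the generalised z.\<close>
proof (induction k arbitrary: z)
  case 0
  then show ?case by (simp add: g)
next
  case (Suc k)
  have "EK_diff_op \<sigma> ((EK_diff_op \<sigma> ^^ k) g) z =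
      (\<Sum>i\<in>I. c i * rGamma (e i - real k) * (b powr \<sigma> - z powr \<sigma>) powr (e i - real k - 1))"
    by (rule EK_diff_op_power_sum(2) [OF assms(1,2) Suc.prems Suc.IH])
  then show ?case
    by (simp add: algebra_simps)
qed

context EK_power_sum
begin

lemma EK_deriv_exists:
  assumes "\<mu> > 0" "z \<in> {0<..<b}"
  shows "EK_deriv_exists b \<sigma> \<eta> \<mu> f z"
proof -
  define n where "n = nat \<lceil>\<mu>\<rceil>"
  have "eventually (\<lambda>t. t \<in> {0<..<b}) (nhds z)"
    using assms(2) by (intro eventually_nhds_in_open) auto
  then have "\<forall>\<^sub>F z in nhds z.
     (\<mu> < real n \<longrightarrow>
        EK_integrand \<sigma> (\<eta> + \<mu> - real n) (real n - \<mu>) f z absolutely_integrable_on {z..b}) \<and>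
     (\<forall>k<n. (EK_diff_op \<sigma> ^^ k) (EK_inner b \<sigma> \<eta> \<mu> f) field_differentiable at z)"
  proof (rule eventually_mono, intro conjI impI allI)
    fix t assume t: "t \<in> {0<..<b}"
    show "EK_integrand \<sigma> (\<eta> + \<mu> - real n) (real n - \<mu>) f t absolutely_integrable_on {t..b}"
      if "\<mu> < real n"
      using EK_integrand(1) [of "real n - \<mu>" t] that t by (simp add: algebra_simps)
    show "(EK_diff_op \<sigma> ^^ k) (EK_inner b \<sigma> \<eta> \<mu> f) field_differentiable at t" for k
      by (rule EK_diff_op_power_sum(1) [OF \<sigma> finite_I t
            EK_diff_op_funpow_power_sum [OF \<sigma> finite_I EK_inner_eq [OF assms(1)]]])
  qed
  then show ?thesis
    by (simp add: EK_deriv_exists_def n_def Let_def)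
qed

text \<open>The exponents rise by n - \<mu> under the integral and drop by n under differentiation,
  so the ceiling n disappears.\<close>

lemma EK_deriv_eq:
  assumes "\<mu> > 0" "z \<in> {0<..<b}"
  shows "EK_deriv b \<sigma> \<eta> \<mu> f z = z powr (\<sigma> * (\<eta> + \<mu>)) *
    (\<Sum>i\<in>I. c i * (Gamma (e i + 1) * rGamma (e i - \<mu> + 1)) * (b powr \<sigma> - z powr \<sigma>) powr (e i - \<mu>))"
proof -
  define n where "n = nat \<lceil>\<mu>\<rceil>"
  have "(EK_diff_op \<sigma> ^^ n) (EK_inner b \<sigma> \<eta> \<mu> f) z =
      (\<Sum>i\<in>I. c i * Gamma (e i + 1) * rGamma (e i + real n - \<mu> - real n + 1) *
         (b powr \<sigma> - z powr \<sigma>) powr (e i + real n - \<mu> - real n))"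
    unfolding n_def
    by (rule EK_diff_op_funpow_power_sum [OF \<sigma> finite_I EK_inner_eq [OF assms(1)] assms(2)])
  then show ?thesis
    by (simp add: EK_deriv_def n_def mult_ac)
qed

end

section \<open>The differentiation matrix\<close>

text \<open>At y = 2 (t/b)^\<sigma> - 1 the expansion variable (y - 1) / 2 equals -(B - X) / B, so
  the expansion at y = 1 is already one in powers of B - X.\<close>

lemma jacobi_muntz2_power_sum:
  assumes "t \<in> {0<..<b}" "\<sigma> > 0"
  shows "jacobi_muntz2 b j \<alpha> \<beta> \<sigma> \<eta> t = t powr (\<sigma> * \<eta>) *
    (\<Sum>k\<le>j. ((real j + \<alpha>) gchoose (j - k)) * ((real j + \<alpha> + \<beta> + real k) gchoose k) *
       (- 1 / b powr \<sigma>) ^ k * (b powr \<sigma> - t powr \<sigma>) powr (\<alpha> + real k))"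
proof -
  let ?B = "b powr \<sigma>"
  have pos: "?B - t powr \<sigma> > 0" "?B > 0"
    using assms by (auto simp: powr_less_mono2)
  have "poly [:- 1 / 2, 1 / 2:] (2 * (t / b) powr \<sigma> - 1) = (t / b) powr \<sigma> - 1"
    by (simp add: field_simps)
  also have "\<dots> = - 1 / ?B * (?B - t powr \<sigma>)"
    using assms(1) pos by (simp add: powr_divide field_simps)
  finally have lin: "poly [:- 1 / 2, 1 / 2:] (2 * (t / b) powr \<sigma> - 1) = - 1 / ?B * (?B - t powr \<sigma>)" .
  have "poly (jacobi_poly j \<alpha> \<beta>) (2 * (t / b) powr \<sigma> - 1) =
      (\<Sum>k\<le>j. ((real j + \<alpha>) gchoose (j - k)) * ((real j + \<alpha> + \<beta> + real k) gchoose k) *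
         (- 1 / ?B * (?B - t powr \<sigma>)) ^ k)"
    unfolding jacobi_poly_def poly_sum poly_smult poly_power lin ..
  then have "jacobi_muntz2 b j \<alpha> \<beta> \<sigma> \<eta> t = t powr (\<sigma> * \<eta>) * ((?B - t powr \<sigma>) powr \<alpha> *
      (\<Sum>k\<le>j. ((real j + \<alpha>) gchoose (j - k)) * ((real j + \<alpha> + \<beta> + real k) gchoose k) *
         (- 1 / ?B * (?B - t powr \<sigma>)) ^ k))"
    by (simp only: jacobi_muntz2_def mult.assoc)
  also have "(?B - t powr \<sigma>) powr \<alpha> *
      (\<Sum>k\<le>j. ((real j + \<alpha>) gchoose (j - k)) * ((real j + \<alpha> + \<beta> + real k) gchoose k) *
         (- 1 / ?B * (?B - t powr \<sigma>)) ^ k) =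
      (\<Sum>k\<le>j. ((real j + \<alpha>) gchoose (j - k)) * ((real j + \<alpha> + \<beta> + real k) gchoose k) *
       (- 1 / ?B) ^ k * (?B - t powr \<sigma>) powr (\<alpha> + real k))"
    unfolding sum_distrib_left power_mult_distrib
    using pos by (intro sum.cong refl) (simp add: powr_add powr_realpow)
  finally show ?thesis .
qed

text \<open>In the term (j, k), the factor Gamma (\<alpha> + k + 1) / Gamma (\<alpha> - \<mu> + k +
  1) turns the first binomial into the one for \<alpha> - \<mu>, up to a quotient free of k. The
  second binomial depends only on \<alpha> + \<beta>; keeping that sum fixed is why \<beta> becomes
  \<beta> + \<mu>.\<close>

lemma EK_deriv_jacobi_muntz2_sum:
  fixes b \<sigma> \<alpha> \<beta> \<eta> \<mu> z :: real
  assumes "\<sigma> > 0" "\<alpha> > -1" "\<mu> > 0" "\<alpha> - \<mu> > -1" and z: "z \<in> {0<..<b}"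
    and f: "\<And>t. t \<in> {0<..<b} \<Longrightarrow> f t = (\<Sum>j\<le>N. C j * jacobi_muntz2 b j \<alpha> \<beta> \<sigma> \<eta> t)"
  shows "EK_deriv_exists b \<sigma> \<eta> \<mu> f z"
    and "EK_deriv b \<sigma> \<eta> \<mu> f z =
      (\<Sum>j\<le>N. C j * (Gamma (real j + \<alpha> + 1) / Gamma (real j + \<alpha> - \<mu> + 1)) *
         jacobi_muntz2 b j (\<alpha> - \<mu>) (\<beta> + \<mu>) \<sigma> (\<eta> + \<mu>) z)"
proof -
  let ?I = "SIGMA j:{..N}. {..j}"
  define c where "c = (\<lambda>(j, k). C j * (((real j + \<alpha>) gchoose (j - k)) *
    ((real j + \<alpha> + \<beta> + real k) gchoose k) * (- 1 / b powr \<sigma>) ^ k))"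
  define e where "e = (\<lambda>(j :: nat, k). \<alpha> + real k)"
  interpret EK_power_sum b \<sigma> \<eta> ?I c e f
  proof
    fix t assume t: "t \<in> {0<..<b}"
    have "f t = (\<Sum>j\<le>N. \<Sum>k\<le>j. t powr (\<sigma> * \<eta>) * (c (j, k) * (b powr \<sigma> - t powr \<sigma>) powr e (j, k)))"
      unfolding f [OF t] jacobi_muntz2_power_sum [OF t assms(1)] sum_distrib_left
      by (intro sum.cong refl) (simp add: c_def e_def mult_ac)
    also have "\<dots> = (\<Sum>i\<in>?I. t powr (\<sigma> * \<eta>) * (c i * (b powr \<sigma> - t powr \<sigma>) powr e i))"
      by (subst sum.Sigma) (auto simp: case_prod_beta)
    finally show "f t = t powr (\<sigma> * \<eta>) * (\<Sum>i\<in>?I. c i * (b powr \<sigma> - t powr \<sigma>) powr e i)"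
      by (simp add: sum_distrib_left)
  next
    fix i assume "i \<in> ?I"
    then show "e i > -1"
      using assms(2) by (auto simp: e_def intro: less_le_trans)
  qed (use assms(1) in auto)
  show "EK_deriv_exists b \<sigma> \<eta> \<mu> f z"
    by (rule EK_deriv_exists [OF assms(3) z])
  have "EK_deriv b \<sigma> \<eta> \<mu> f z =
      (\<Sum>i\<in>?I. z powr (\<sigma> * (\<eta> + \<mu>)) * (c i * (Gamma (e i + 1) * rGamma (e i - \<mu> + 1)) *
         (b powr \<sigma> - z powr \<sigma>) powr (e i - \<mu>)))"
    by (simp add: EK_deriv_eq [OF assms(3) z] sum_distrib_left)
  also have "\<dots> = (\<Sum>j\<le>N. \<Sum>k\<le>j. z powr (\<sigma> * (\<eta> + \<mu>)) * (c (j, k) *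
      (Gamma (e (j, k) + 1) * rGamma (e (j, k) - \<mu> + 1)) *
      (b powr \<sigma> - z powr \<sigma>) powr (e (j, k) - \<mu>)))"
    by (subst sum.Sigma) (auto simp: case_prod_beta)
  also have "\<dots> = (\<Sum>j\<le>N. C j * (Gamma (real j + \<alpha> + 1) / Gamma (real j + \<alpha> - \<mu> + 1)) *
         jacobi_muntz2 b j (\<alpha> - \<mu>) (\<beta> + \<mu>) \<sigma> (\<eta> + \<mu>) z)"
    unfolding jacobi_muntz2_power_sum [OF z assms(1)] sum_distrib_left
  proof (intro sum.cong refl)
    fix j k :: nat assume "k \<in> {..j}"
    then have k: "k \<le> j" by simp
    let ?G = "Gamma (real j + \<alpha> + 1)" and ?G' = "Gamma (real j + \<alpha> - \<mu> + 1)"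
    \<comment> \<open>Here \<alpha> - \<mu> > -1 enters: the Gamma values are positive, so
      \<open>rGamma\<close> is a genuine reciprocal that can be cancelled.\<close>
    have pos: "Gamma (\<alpha> - \<mu> + real k + 1) > 0" "?G' > 0"
      using assms(4) by (intro Gamma_real_pos; linarith)+
    have "Gamma (\<alpha> + real k + 1) * ((real j + \<alpha>) gchoose (j - k)) = ?G / fact (j - k)"
      by (rule Gamma_mult_gbinomial_diff [OF assms(2) k])
    moreover have "Gamma (\<alpha> - \<mu> + real k + 1) * ((real j + (\<alpha> - \<mu>)) gchoose (j - k)) = ?G' / fact (j - k)"
      using Gamma_mult_gbinomial_diff [OF assms(4) k] by (simp add: algebra_simps)
    ultimately have "((real j + \<alpha>) gchoose (j - k)) * Gamma (\<alpha> + real k + 1) =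
        ?G / ?G' * (Gamma (\<alpha> - \<mu> + real k + 1) * ((real j + (\<alpha> - \<mu>)) gchoose (j - k)))"
      using pos by (simp add: mult.commute)
    then have *: "((real j + \<alpha>) gchoose (j - k)) *
        (Gamma (\<alpha> + real k + 1) * rGamma (\<alpha> + real k - \<mu> + 1)) =
        ?G / ?G' * ((real j + (\<alpha> - \<mu>)) gchoose (j - k))"
      using pos by (simp add: rGamma_inverse_Gamma field_simps)
    have "real j + (\<alpha> - \<mu>) + (\<beta> + \<mu>) + real k = real j + \<alpha> + \<beta> + real k"
      and "\<alpha> - \<mu> + real k = \<alpha> + real k - \<mu>" by simp_all
    then show "z powr (\<sigma> * (\<eta> + \<mu>)) * (c (j, k) *
        (Gamma (e (j, k) + 1) * rGamma (e (j, k) - \<mu> + 1)) *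
        (b powr \<sigma> - z powr \<sigma>) powr (e (j, k) - \<mu>)) =
      C j * (?G / ?G') * (z powr (\<sigma> * (\<eta> + \<mu>)) *
        (((real j + (\<alpha> - \<mu>)) gchoose (j - k)) *
         ((real j + (\<alpha> - \<mu>) + (\<beta> + \<mu>) + real k) gchoose k) *
         (- 1 / b powr \<sigma>) ^ k * (b powr \<sigma> - z powr \<sigma>) powr (\<alpha> - \<mu> + real k)))"
      using arg_cong [OF *, of "\<lambda>v. v * (C j * ((real j + \<alpha> + \<beta> + real k) gchoose k) *
          (- 1 / b powr \<sigma>) ^ k * z powr (\<sigma> * (\<eta> + \<mu>)) * (b powr \<sigma> - z powr \<sigma>) powr (\<alpha> + real k - \<mu>))"]
      by (simp only: c_def e_def prod.case mult_ac)
  qed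
  finally show "EK_deriv b \<sigma> \<eta> \<mu> f z =
      (\<Sum>j\<le>N. C j * (Gamma (real j + \<alpha> + 1) / Gamma (real j + \<alpha> - \<mu> + 1)) *
         jacobi_muntz2 b j (\<alpha> - \<mu>) (\<beta> + \<mu>) \<sigma> (\<eta> + \<mu>) z)" .
qed

section \<open>Transport of the Gauss data to the interval from 0 to b\<close>

context
  fixes b \<sigma> \<alpha> \<beta> :: real and N :: nat
  assumes b: "b > 0" and \<sigma>: "\<sigma> > 0" and \<alpha>: "\<alpha> > -1" and \<beta>: "\<beta> > -1"
begin

lemma mapped_node_powr:
  assumes "r \<le> N"
  shows "mapped_node b \<sigma> N \<alpha> \<beta> r powr \<sigma> = b powr \<sigma> * ((1 + gauss_jacobi_node N \<alpha> \<beta> r) / 2)"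
  using gauss_jacobi_node_bounds [OF \<alpha> \<beta> assms] b \<sigma>
  by (simp add: mapped_node_def powr_mult powr_powr)

lemma mapped_node_unmap:
  assumes "r \<le> N"
  shows "2 * (mapped_node b \<sigma> N \<alpha> \<beta> r / b) powr \<sigma> - 1 = gauss_jacobi_node N \<alpha> \<beta> r"
  using gauss_jacobi_node_bounds [OF \<alpha> \<beta> assms] b \<sigma>
  by (simp add: mapped_node_def powr_powr add_divide_distrib)

lemma mapped_node_bounds:
  assumes "r \<le> N"
  shows "mapped_node b \<sigma> N \<alpha> \<beta> r \<in> {0<..<b}"
proof -
  let ?v = "(1 + gauss_jacobi_node N \<alpha> \<beta> r) / 2"
  have v: "0 < ?v" "?v < 1"
    using gauss_jacobi_node_bounds [OF \<alpha> \<beta> assms] by auto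
  then have "?v powr (1 / \<sigma>) < 1 powr (1 / \<sigma>)"
    using \<sigma> by (intro powr_less_mono2) auto
  then show ?thesis
    using v b by (simp add: mapped_node_def)
qed

lemma inj_on_mapped_node: "inj_on (mapped_node b \<sigma> N \<alpha> \<beta>) {..N}"
proof (rule inj_onI)
  fix r s assume "r \<in> {..N}" "s \<in> {..N}" "mapped_node b \<sigma> N \<alpha> \<beta> r = mapped_node b \<sigma> N \<alpha> \<beta> s"
  then show "r = s"
    using mapped_node_unmap [of r] mapped_node_unmap [of s] inj_onD [OF inj_on_gauss_jacobi_node [OF \<alpha> \<beta>, of N]]
    by auto
qed

text \<open>\<open>t powr \<sigma>\<close> is affine in y = 2 (t/b)^\<sigma> - 1, and its slope
  \<open>b powr \<sigma> / 2\<close> cancels in each quotient.\<close>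

lemma muntz_lagrange_eq:
  assumes "i \<le> N" "t > 0"
  shows "muntz_lagrange \<sigma> N (mapped_node b \<sigma> N \<alpha> \<beta>) i t =
    poly (lagrange_basis_poly N (gauss_jacobi_node N \<alpha> \<beta>) i) (2 * (t / b) powr \<sigma> - 1)"
  unfolding muntz_lagrange_def poly_lagrange_basis_poly
proof (intro prod.cong refl)
  fix j assume j: "j \<in> {..N} - {i}"
  let ?y = "gauss_jacobi_node N \<alpha> \<beta>" and ?v = "2 * (t / b) powr \<sigma> - 1"
  have B: "b powr \<sigma> / 2 \<noteq> 0" using b by simp
  have "t powr \<sigma> = b powr \<sigma> * ((1 + ?v) / 2)"
    using b assms by (simp add: powr_divide)
  then have "t powr \<sigma> - mapped_node b \<sigma> N \<alpha> \<beta> j powr \<sigma> = b powr \<sigma> / 2 * (?v - ?y j)"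
    using j by (simp add: mapped_node_powr field_simps)
  moreover have "mapped_node b \<sigma> N \<alpha> \<beta> i powr \<sigma> - mapped_node b \<sigma> N \<alpha> \<beta> j powr \<sigma> =
      b powr \<sigma> / 2 * (?y i - ?y j)"
    using j assms by (simp add: mapped_node_powr field_simps)
  ultimately show "(t powr \<sigma> - mapped_node b \<sigma> N \<alpha> \<beta> j powr \<sigma>) /
      (mapped_node b \<sigma> N \<alpha> \<beta> i powr \<sigma> - mapped_node b \<sigma> N \<alpha> \<beta> j powr \<sigma>) =
      (?v - ?y j) / (?y i - ?y j)"
    by (simp only: mult_divide_mult_cancel_left [OF B])
qed

lemma interpolant2_jacobi_muntz2_expansion:
  fixes \<eta> :: real and u :: "real \<Rightarrow> real"
  assumes "t \<in> {0<..<b}"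
  defines "x \<equiv> mapped_node b \<sigma> N \<alpha> \<beta>"
  shows "interpolant2 b \<alpha> \<sigma> \<eta> N x u t =
    (\<Sum>j\<le>N. (\<Sum>i\<le>N. u (x i) * ((1 / x i) powr (\<sigma> * \<eta>) * (1 / (b powr \<sigma> - x i powr \<sigma>)) powr \<alpha> *
        (mapped_weight b \<sigma> N \<alpha> \<beta> i / mapped_gamma b \<sigma> j \<alpha> \<beta> *
           poly (jacobi_poly j \<alpha> \<beta>) (2 * (x i / b) powr \<sigma> - 1)))) *
      jacobi_muntz2 b j \<alpha> \<beta> \<sigma> \<eta> t)"
proof -
  let ?a = "\<lambda>i j. mapped_weight b \<sigma> N \<alpha> \<beta> i / mapped_gamma b \<sigma> j \<alpha> \<beta> *
    poly (jacobi_poly j \<alpha> \<beta>) (2 * (x i / b) powr \<sigma> - 1)"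
  let ?K = "\<lambda>i. (1 / x i) powr (\<sigma> * \<eta>) * (1 / (b powr \<sigma> - x i powr \<sigma>)) powr \<alpha>"
  let ?v = "2 * (t / b) powr \<sigma> - 1"
  have "u (x i) * (t / x i) powr (\<sigma> * \<eta>) * ((b powr \<sigma> - t powr \<sigma>) / (b powr \<sigma> - x i powr \<sigma>)) powr \<alpha> *
        muntz_lagrange \<sigma> N x i t =
      (\<Sum>j\<le>N. u (x i) * (?K i * ?a i j) * jacobi_muntz2 b j \<alpha> \<beta> \<sigma> \<eta> t)" if i: "i \<le> N" for i
  proof -
    have x: "0 < x i" "x i < b"
      using mapped_node_bounds [OF i] by (auto simp: x_def)
    have pos: "b powr \<sigma> - x i powr \<sigma> > 0" "b powr \<sigma> - t powr \<sigma> > 0"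
      using x assms(1) \<sigma> by (auto simp: powr_less_mono2)
    \<comment> \<open>This factor is common to \<open>mapped_weight\<close> and
      \<open>mapped_gamma\<close>; once it cancels, the coefficients are those of the expansion on
      [-1, 1].\<close>
    have scale: "1 / \<sigma> * (b powr \<sigma> / 2) powr (\<alpha> + \<beta> + 1) \<noteq> 0"
      using \<sigma> b by simp
    have a: "?a i j = gauss_jacobi_weight N \<alpha> \<beta> i / jacobi_gamma j \<alpha> \<beta> *
        poly (jacobi_poly j \<alpha> \<beta>) (gauss_jacobi_node N \<alpha> \<beta> i)" for j
      unfolding mapped_weight_def mapped_gamma_def x_def mapped_node_unmap [OF i]
        mult_divide_mult_cancel_left [OF scale] ..
    have "muntz_lagrange \<sigma> N x i t = (\<Sum>j\<le>N. ?a i j * poly (jacobi_poly j \<alpha> \<beta>) ?v)"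
      unfolding a using muntz_lagrange_eq [OF i, of t] assms(1)
        lagrange_basis_poly_jacobi_expansion [OF \<alpha> \<beta> i]
      by (simp add: x_def poly_sum)
    moreover have "(t / x i) powr (\<sigma> * \<eta>) = t powr (\<sigma> * \<eta>) * (1 / x i) powr (\<sigma> * \<eta>)"
      using x assms(1) by (simp add: powr_divide)
    moreover have "((b powr \<sigma> - t powr \<sigma>) / (b powr \<sigma> - x i powr \<sigma>)) powr \<alpha> =
        (b powr \<sigma> - t powr \<sigma>) powr \<alpha> * (1 / (b powr \<sigma> - x i powr \<sigma>)) powr \<alpha>"
      using pos by (simp add: powr_divide)
    ultimately show ?thesis
      unfolding jacobi_muntz2_def
      by (simp only: sum_distrib_left) (intro sum.cong refl, simp only: mult_ac)
  qed
  then have "interpolant2 b \<alpha> \<sigma> \<eta> N x u t =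
      (\<Sum>i\<le>N. \<Sum>j\<le>N. u (x i) * (?K i * ?a i j) * jacobi_muntz2 b j \<alpha> \<beta> \<sigma> \<eta> t)"
    unfolding interpolant2_def by (intro sum.cong refl) simp
  also have "\<dots> = (\<Sum>j\<le>N. \<Sum>i\<le>N. u (x i) * (?K i * ?a i j) * jacobi_muntz2 b j \<alpha> \<beta> \<sigma> \<eta> t)"
    by (rule sum.swap)
  finally show ?thesis
    by (simp only: sum_distrib_right)
qed

end

text \<open>The first conjunct excludes that the derivative is a default value of
  \<open>integral\<close> or \<open>deriv\<close>. The equivalence says both that the formula gives
  a differentiation matrix and that no other entries do.\<close>

theorem theorem3p19:
  fixes b \<sigma> \<alpha> \<beta> \<eta> \<mu> :: real and N :: nat
    and x w :: "nat \<Rightarrow> real" and a :: "nat \<Rightarrow> nat \<Rightarrow> real"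
  assumes "b > 0" and "\<sigma> > 0" and "\<alpha> > -1" and "\<beta> > -1" and "\<mu> > 0" and "\<alpha> - \<mu> > -1"
  defines "x \<equiv> mapped_node b \<sigma> N \<alpha> \<beta>"
    and "w \<equiv> mapped_weight b \<sigma> N \<alpha> \<beta>"
    and "a \<equiv> \<lambda>i j. w i / mapped_gamma b \<sigma> j \<alpha> \<beta> *
                poly (jacobi_poly j \<alpha> \<beta>) (2 * (x i / b) powr \<sigma> - 1)"
  shows "(\<forall>u. continuous_on {0<..<b} u \<longrightarrow>
            (\<forall>s\<le>N. EK_deriv_exists b \<sigma> \<eta> \<mu> (interpolant2 b \<alpha> \<sigma> \<eta> N x u) (x s))) \<and>
         (\<forall>d. is_right_EK_diff_matrix b \<alpha> \<sigma> \<eta> \<mu> N x d \<longleftrightarrow>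
            (\<forall>s\<le>N. \<forall>i\<le>N.
               d s i = (1 / x i) powr (\<sigma> * \<eta>) * (1 / (b powr \<sigma> - x i powr \<sigma>)) powr \<alpha> *
                 (\<Sum>j\<le>N. a i j * (Gamma (real j + \<alpha> + 1) / Gamma (real j + \<alpha> - \<mu> + 1)) *
                    jacobi_muntz2 b j (\<alpha> - \<mu>) (\<beta> + \<mu>) \<sigma> (\<eta> + \<mu>) (x s))))"
proof -
  let ?K = "\<lambda>i. (1 / x i) powr (\<sigma> * \<eta>) * (1 / (b powr \<sigma> - x i powr \<sigma>)) powr \<alpha>"
  let ?C = "\<lambda>u j. \<Sum>i\<le>N. u (x i) * (?K i * a i j)"
  let ?g = "\<lambda>j. Gamma (real j + \<alpha> + 1) / Gamma (real j + \<alpha> - \<mu> + 1)"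
  let ?J = "\<lambda>s j. jacobi_muntz2 b j (\<alpha> - \<mu>) (\<beta> + \<mu>) \<sigma> (\<eta> + \<mu>) (x s)"
  define D where "D s i = ?K i * (\<Sum>j\<le>N. a i j * ?g j * ?J s j)" for s i
  have expansion: "interpolant2 b \<alpha> \<sigma> \<eta> N x u t = (\<Sum>j\<le>N. ?C u j * jacobi_muntz2 b j \<alpha> \<beta> \<sigma> \<eta> t)"
    if "t \<in> {0<..<b}" for u t
    using interpolant2_jacobi_muntz2_expansion [OF assms(1-4) that, where N = N and \<eta> = \<eta> and u = u]
    unfolding a_def w_def x_def .
  have x: "x s \<in> {0<..<b}" if "s \<le> N" for s
    using mapped_node_bounds [OF assms(1-4) that] by (simp add: x_def)
  have EK: "EK_deriv_exists b \<sigma> \<eta> \<mu> (interpolant2 b \<alpha> \<sigma> \<eta> N x u) (x s)"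
    "EK_deriv b \<sigma> \<eta> \<mu> (interpolant2 b \<alpha> \<sigma> \<eta> N x u) (x s) = (\<Sum>j\<le>N. ?C u j * ?g j * ?J s j)"
    if "s \<le> N" for u s
    by (rule EK_deriv_jacobi_muntz2_sum [OF assms(2,3,5,6) x [OF that] expansion], assumption)+
  have deriv: "EK_deriv b \<sigma> \<eta> \<mu> (interpolant2 b \<alpha> \<sigma> \<eta> N x u) (x s) = (\<Sum>i\<le>N. D s i * u (x i))"
    if "s \<le> N" for u s
  proof -
    have "EK_deriv b \<sigma> \<eta> \<mu> (interpolant2 b \<alpha> \<sigma> \<eta> N x u) (x s) =
        (\<Sum>j\<le>N. \<Sum>i\<le>N. u (x i) * (?K i * a i j) * ?g j * ?J s j)"
      unfolding EK(2) [OF that] sum_distrib_right ..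
    also have "\<dots> = (\<Sum>i\<le>N. \<Sum>j\<le>N. u (x i) * (?K i * a i j) * ?g j * ?J s j)"
      by (rule sum.swap)
    also have "\<dots> = (\<Sum>i\<le>N. D s i * u (x i))"
      unfolding D_def sum_distrib_left sum_distrib_right
      by (intro sum.cong refl) (simp only: mult_ac)
    finally show ?thesis .
  qed
  have unique: "d s i = D s i"
    if d: "is_right_EK_diff_matrix b \<alpha> \<sigma> \<eta> \<mu> N x d" and "s \<le> N" "i \<le> N" for d s i
  proof -
    \<comment> \<open>The test function is a polynomial in x itself, not in x^\<sigma>: only its
      continuity and its node values matter.\<close>
    let ?u = "poly (lagrange_basis_poly N x i)"
    have u: "?u (x k) = (if i = k then 1 else 0)" if "k \<le> N" for k
      using poly_lagrange_basis_poly_node [OF inj_on_mapped_node [OF assms(1-4)] \<open>i \<le> N\<close> that]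
      by (simp add: x_def)
    have "(\<Sum>k\<le>N. d s k * ?u (x k)) = (\<Sum>k\<le>N. D s k * ?u (x k))"
      using d \<open>s \<le> N\<close> deriv [OF \<open>s \<le> N\<close>, of ?u]
      unfolding is_right_EK_diff_matrix_def by (simp add: continuous_intros)
    moreover have "(\<Sum>k\<le>N. h k * ?u (x k)) = h i" for h
    proof -
      have "(\<Sum>k\<le>N. h k * ?u (x k)) = (\<Sum>k\<le>N. if i = k then h k else 0)"
        by (intro sum.cong refl) (simp add: u)
      then show ?thesis using \<open>i \<le> N\<close> by simp
    qed
    ultimately show ?thesis by simp
  qed
  have "is_right_EK_diff_matrix b \<alpha> \<sigma> \<eta> \<mu> N x d \<longleftrightarrow> (\<forall>s\<le>N. \<forall>i\<le>N. d s i = D s i)" for d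
    using unique by (auto simp: is_right_EK_diff_matrix_def deriv)
  then show ?thesis
    using EK(1) unfolding D_def by blast
qed

end
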